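(* Let $A,B$ be positive definite matrices and let $t\in[-1,\tfrac12]$ with $t\neq0$. Then \[ A\,\widehat{sp}_t\,B\prec_{\log}\left(A^{\frac{1-t}{2t}}BA^{\frac{1-t}{2t}}\right)^t. \]
   Context: For positive definite matrices $A,B$ and $t\in\mathbb{R}$: $A\sharp B:=A^{1/2}(A^{-1/2}BA^{-1/2})^{1/2}A^{1/2}$ and $A\,\widehat{sp}_t\,B:=(A^{-1}\sharp B)^tA(A^{-1}\sharp B)^t$. For $n\times n$ positive semidefinite matrices $X,Y$ with eigenvalues $\lambda_1(\cdot)\ge\dots\ge\lambda_n(\cdot)$, $X\prec_{\log}Y$ means $\prod_{j=1}^k\lambda_j(X)\le\prod_{j=1}^k\lambda_j(Y)$ for $k=1,\dots,n-1$ and $\det X=\det Y$. *)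

theory Defs
  imports "Jordan_Normal_Form.Schur_Decomposition" "Jordan_Normal_Form.Char_Poly"
    "HOL-Computational_Algebra.Polynomial"
begin

definition hermitian_mat :: "complex mat \<Rightarrow> bool" where
  "hermitian_mat A \<longleftrightarrow> A \<in> carrier_mat (dim_row A) (dim_row A) \<and> mat_adjoint A = A"

definition pos_def_mat :: "complex mat \<Rightarrow> bool" where
  "pos_def_mat A \<longleftrightarrow> hermitian_mat A \<and>
     (\<forall>v \<in> carrier_vec (dim_row A). v \<noteq> 0\<^sub>v (dim_row A) \<longrightarrow> Re ((A *\<^sub>v v) \<bullet>c v) > 0)"

definition unitary_mat :: "nat \<Rightarrow> complex mat \<Rightarrow> bool" where
  "unitary_mat n U \<longleftrightarrow> U \<in> carrier_mat n n \<and> U * mat_adjoint U = 1\<^sub>m n \<and> mat_adjoint U * U = 1\<^sub>m n"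

definition rdiag_mat :: "nat \<Rightarrow> (nat \<Rightarrow> real) \<Rightarrow> complex mat" where
  "rdiag_mat n d = mat n n (\<lambda>(i,j). if i = j then complex_of_real (d i) else 0)"

definition mat_powr :: "complex mat \<Rightarrow> real \<Rightarrow> complex mat" where
  "mat_powr A s = (SOME P. \<exists>U d. unitary_mat (dim_row A) U \<and> (\<forall>i < dim_row A. d i > 0) \<and>
      A = U * rdiag_mat (dim_row A) d * mat_adjoint U \<and>
      P = U * rdiag_mat (dim_row A) (\<lambda>i. d i powr s) * mat_adjoint U)"

definition geo_mean :: "complex mat \<Rightarrow> complex mat \<Rightarrow> complex mat" where
  "geo_mean A B = mat_powr A (1/2) *
     mat_powr (mat_powr A (-1/2) * B * mat_powr A (-1/2)) (1/2) * mat_powr A (1/2)"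

definition sp_hat :: "real \<Rightarrow> complex mat \<Rightarrow> complex mat \<Rightarrow> complex mat" where
  "sp_hat t A B = mat_powr (geo_mean (mat_powr A (-1)) B) t * A * mat_powr (geo_mean (mat_powr A (-1)) B) t"

text \<open>Eigenvalues (with multiplicity, real parts) in decreasing order:
  eigs X ! (j-1) = lambda_j(X).\<close>
definition eigs :: "complex mat \<Rightarrow> real list" where
  "eigs X = rev (sorted_list_of_multiset (image_mset Re (proots (char_poly X))))"

definition log_majorized :: "complex mat \<Rightarrow> complex mat \<Rightarrow> bool" where
  "log_majorized X Y \<longleftrightarrow>
     (\<forall>k \<in> {1..<dim_row X}. (\<Prod>j<k. eigs X ! j) \<le> (\<Prod>j<k. eigs Y ! j)) \<and> det X = det Y"

end

theory Submission
  imports Defs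
begin

text \<open>
  The matrix \<open>C = A\<^sup>-\<^sup>1 # B\<close> solves \<open>C A C = B\<close>, so both sides are expressed by powers of \<open>A\<close> and \<open>C\<close>:
  writing \<open>\<sigma>(T)\<close> for the product of the \<open>k\<close> largest eigenvalues of \<open>T\<^sup>* T\<close> and \<open>p = (1 - t) / (2 t)\<close>, the
  claim for \<open>t > 0\<close> is \<open>\<sigma>(A\<^bsup>1/2\<^esup> C\<^sup>t) \<le> \<sigma>(A\<^bsup>1/2\<^esup> C A\<^sup>p)\<^sup>t\<close>, and the one for \<open>t < 0\<close> is similar with \<open>C\<^sup>-\<^sup>1\<close>.

  Instead of antisymmetric tensor powers, \<open>\<sigma>(T)\<close> is the best constant \<open>c\<close> with
  \<open>det ((T V)\<^sup>* (T V)) \<le> c det (V\<^sup>* V)\<close> for all \<open>n \<times> k\<close> matrices \<open>V\<close>, which makes it submultiplicative for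
  trivial reasons. Since \<open>T\<^sup>* T\<close> for \<open>T = P\<^sup>m X Q\<^sup>m\<close>, \<open>m = (a + b) / 2\<close>, is similar to
  \<open>(P\<^sup>a X Q\<^sup>a)\<^sup>* (P\<^sup>b X Q\<^sup>b)\<close>, the function \<open>x \<mapsto> \<sigma>(P\<^sup>x X Q\<^sup>x)\<close> is log-convex. With \<open>X = 1\<close> this
  gives the Cordes inequality \<open>\<sigma>(P\<^sup>x Q\<^sup>x) \<le> \<sigma>(P Q)\<^sup>x\<close> for \<open>0 \<le> x \<le> 1\<close>; with \<open>Q = P\<^sup>-\<^sup>1\<close> and Hermitian
  \<open>X\<close> the function is moreover even, hence increasing in \<open>|x|\<close>. The two facts together yield the claim.
\<close>

section \<open>Adjoints and unitary matrices\<close>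

abbreviation adj :: "complex mat \<Rightarrow> complex mat" where "adj \<equiv> mat_adjoint"

lemma adj_carrier [simp]: "M \<in> carrier_mat m n \<Longrightarrow> adj M \<in> carrier_mat n m"
  by (auto simp: mat_adjoint_def mat_of_rows_def)

lemma dim_adj [simp]: "dim_row (adj M) = dim_col M" "dim_col (adj M) = dim_row M"
  by (auto simp: mat_adjoint_def mat_of_rows_def)

lemma index_adj [simp]:
  "i < dim_col M \<Longrightarrow> j < dim_row M \<Longrightarrow> adj M $$ (i, j) = cnj (M $$ (j, i))"
  by (auto simp: mat_adjoint_def mat_of_rows_def)

lemma square_mult_carrier [simp]:
  "M \<in> carrier_mat n n \<Longrightarrow> N \<in> carrier_mat n k \<Longrightarrow> M * N \<in> carrier_mat n k"
  by (rule mult_carrier_mat)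

lemma index_mult_sum:
  "M \<in> carrier_mat m n \<Longrightarrow> N \<in> carrier_mat n l \<Longrightarrow> i < m \<Longrightarrow> j < l \<Longrightarrow>
    (M * N) $$ (i, j) = (\<Sum>k<n. M $$ (i, k) * N $$ (k, j))"
  by (auto simp: scalar_prod_def lessThan_atLeast0 intro!: sum.cong)

lemma adj_adj [simp]: "adj (adj M) = M"
  by (rule eq_matI) auto

lemma adj_mult:
  "M \<in> carrier_mat m n \<Longrightarrow> N \<in> carrier_mat n l \<Longrightarrow> adj (M * N) = adj N * adj M"
  by (rule eq_matI) (auto simp: scalar_prod_def intro!: sum.cong)

lemma adj_one [simp]: "adj (1\<^sub>m n) = 1\<^sub>m n"
  by (rule eq_matI) auto

lemma det_adj:
  assumes "M \<in> carrier_mat n n" shows "det (adj M) = cnj (det M)"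
proof -
  have "adj M = map_mat cnj (transpose_mat M)"
    using assms by (intro eq_matI) auto
  moreover have "det (map_mat cnj (transpose_mat M)) = cnj (det (transpose_mat M))"
    using assms by (simp add: det_def cnj_sum)
  ultimately show ?thesis using assms by (simp add: det_transpose)
qed

lemma rdiag_carrier [simp]: "rdiag_mat n d \<in> carrier_mat n n"
  by (simp add: rdiag_mat_def)

lemma rdiag_dim [simp]: "dim_row (rdiag_mat n d) = n" "dim_col (rdiag_mat n d) = n"
  by (auto simp: rdiag_mat_def)

lemma index_rdiag [simp]:
  "i < n \<Longrightarrow> j < n \<Longrightarrow> rdiag_mat n d $$ (i, j) = (if i = j then complex_of_real (d i) else 0)"
  by (simp add: rdiag_mat_def)

lemma index_mult_rdiag_left:
  "M \<in> carrier_mat n m \<Longrightarrow> i < n \<Longrightarrow> j < m \<Longrightarrow> (rdiag_mat n d * M) $$ (i, j) = d i * M $$ (i, j)"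
  by (simp add: scalar_prod_def if_distrib[of "\<lambda>x. x * _"] sum.delta cong: if_cong)

lemma index_mult_rdiag_right:
  "M \<in> carrier_mat m n \<Longrightarrow> i < m \<Longrightarrow> j < n \<Longrightarrow> (M * rdiag_mat n d) $$ (i, j) = M $$ (i, j) * d j"
  by (simp add: scalar_prod_def if_distrib[of "\<lambda>x. _ * x"] sum.delta' cong: if_cong)

lemma rdiag_mult: "rdiag_mat n d * rdiag_mat n e = rdiag_mat n (\<lambda>i. d i * e i)"
  by (rule eq_matI) (auto simp: index_mult_rdiag_left[OF rdiag_carrier] simp del: index_mult_mat(1))

lemma rdiag_one: "(\<And>i. i < n \<Longrightarrow> d i = 1) \<Longrightarrow> rdiag_mat n d = 1\<^sub>m n"
  by (rule eq_matI) auto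

lemma rdiag_cong: "(\<And>i. i < n \<Longrightarrow> d i = e i) \<Longrightarrow> rdiag_mat n d = rdiag_mat n e"
  by (rule eq_matI) auto

section \<open>Unitary matrices and completion of a vector to a unitary matrix\<close>

lemma unitary_matD:
  assumes "unitary_mat n U"
  shows "U \<in> carrier_mat n n" "U * adj U = 1\<^sub>m n" "adj U * U = 1\<^sub>m n"
  using assms by (auto simp: unitary_mat_def)

lemma unitary_matI:
  assumes "U \<in> carrier_mat n n" "adj U * U = 1\<^sub>m n"
  shows "unitary_mat n U"
  using assms mat_mult_left_right_inverse[of "adj U" n U] by (auto simp: unitary_mat_def)

lemma unitary_mat_mult:
  assumes "unitary_mat n U" "unitary_mat n V" shows "unitary_mat n (U * V)"
proof -
  note U = unitary_matD[OF assms(1)] and V = unitary_matD[OF assms(2)]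
  have "adj (U * V) * (U * V) = adj V * (adj U * U) * V"
    using U(1) V(1) by (simp add: adj_mult[OF U(1) V(1)] assoc_mult_mat[of _ n n _ n _ n])
  then show ?thesis using U V by (intro unitary_matI) auto
qed

text \<open>A basis completion of \<open>v\<close> is orthogonalised by Gram-Schmidt, which keeps
  the first vector, and then normalised; \<open>c\<close> is the factor this puts on
  \<open>v\<close>. It supplies the change of basis that splits off an eigenvector.\<close>

lemma unitary_with_first_column:
  assumes v: "v \<in> carrier_vec n" "v \<noteq> 0\<^sub>v n"
  obtains W c where "unitary_mat n W" "col W 0 = c \<cdot>\<^sub>v v"
proof -
  interpret cof_vec_space n "TYPE(complex)" .
  define b where "b = basis_completion v"
  define ws where "ws = gram_schmidt n b"
  have n: "n \<noteq> 0" using v by auto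
  from basis_completion[OF v, folded b_def]
  have dist_b: "distinct b" and indep: "\<not> lin_dep (set b)" and b: "set b \<subseteq> carrier_vec n"
    and hdb: "hd b = v" and len_b: "length b = n" by auto
  from hdb len_b n obtain vs where bv: "b = v # vs" by (cases b) auto
  from gram_schmidt_result[OF b dist_b indep refl, folded ws_def]
  have ws: "set ws \<subseteq> carrier_vec n" "corthogonal ws" "length ws = n"
    by (auto simp: len_b)
  from gram_schmidt_hd[OF v(1), of vs, folded bv] have hdws: "hd ws = v" unfolding ws_def .
  \<comment> \<open>Squared norms: Gram-Schmidt makes the vectors orthogonal, not of unit
    length.\<close>
  define g where "g i = (\<Sum>k<n. (cmod (ws ! i $ k))\<^sup>2)" for i
  have wsc: "ws ! i \<in> carrier_vec n" if "i < n" for i using ws that by auto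
  have ip: "ws ! i \<bullet>c ws ! j = (\<Sum>k<n. ws ! i $ k * cnj (ws ! j $ k))" if "i < n" "j < n" for i j
    using wsc[OF that(2)] by (auto simp: scalar_prod_def lessThan_atLeast0 intro!: sum.cong)
  have ip_g: "ws ! i \<bullet>c ws ! i = of_real (g i)" if "i < n" for i
    using ip[OF that that] by (simp add: g_def complex_norm_square[symmetric] del: of_real_power)
  have g: "g i > 0" if "i < n" for i
  proof -
    have "g i \<noteq> 0" using ip_g[OF that] corthogonalD[OF ws(2), of i i] that ws(3) by auto
    moreover have "g i \<ge> 0" by (auto simp: g_def intro: sum_nonneg)
    ultimately show ?thesis by simp
  qed
  define W where "W = mat n n (\<lambda>(i, j). of_real (1 / sqrt (g j)) * (ws ! j $ i))"
  have W: "W \<in> carrier_mat n n" by (simp add: W_def)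
  have "adj W * W = 1\<^sub>m n"
  proof (rule eq_matI)
    fix i j assume "i < dim_row (1\<^sub>m n :: complex mat)" "j < dim_col (1\<^sub>m n :: complex mat)"
    then have ij: "i < n" "j < n" by auto
    have "(adj W * W) $$ (i, j) =
        (\<Sum>k<n. of_real (1 / sqrt (g i) * (1 / sqrt (g j))) * (ws ! j $ k * cnj (ws ! i $ k)))"
      using ij W by (auto simp: scalar_prod_def lessThan_atLeast0 W_def intro!: sum.cong)
    also have "\<dots> = of_real (1 / sqrt (g i) * (1 / sqrt (g j))) * (ws ! j \<bullet>c ws ! i)"
      unfolding ip[OF ij(2,1)] sum_distrib_left ..
    also have "\<dots> = (1\<^sub>m n :: complex mat) $$ (i, j)"
    proof (cases "i = j")
      case True
      then show ?thesis using ij g[OF ij(1)] ip_g[OF ij(1)]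
        by (simp flip: of_real_mult)
    next
      case False
      then show ?thesis using ij corthogonalD[OF ws(2), of j i] ws(3) by auto
    qed
    finally show "(adj W * W) $$ (i, j) = (1\<^sub>m n :: complex mat) $$ (i, j)" .
  qed (use W in auto)
  then have "unitary_mat n W" using W by (rule unitary_matI[rotated])
  moreover have "col W 0 = of_real (1 / sqrt (g 0)) \<cdot>\<^sub>v v"
  proof -
    have "ws ! 0 = v" using hdws ws(3) n by (cases ws) auto
    then show ?thesis using n v W by (intro eq_vecI) (auto simp: W_def)
  qed
  ultimately show thesis by (rule that)
qed

section \<open>The spectral theorem\<close>

text \<open>The entries are complex because eigenvalues are not yet known to be real when a matrix
  is diagonalised.\<close>

definition cdiag_mat :: "nat \<Rightarrow> complex list \<Rightarrow> complex mat" where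
  "cdiag_mat n es = mat n n (\<lambda>(i, j). if i = j then es ! i else 0)"

lemma adj_four_block:
  assumes "A1 \<in> carrier_mat a a" "A2 \<in> carrier_mat a b" "A3 \<in> carrier_mat b a" "A4 \<in> carrier_mat b b"
  shows "adj (four_block_mat A1 A2 A3 A4) = four_block_mat (adj A1) (adj A3) (adj A2) (adj A4)"
  using assms by (intro eq_matI) auto

text \<open>Deflation by induction on \<open>es\<close>: a unitary whose first column is an
  eigenvector for \<open>e\<close> splits off a one-dimensional block, and the remaining block is
  Hermitian with the remaining roots. The eigenvalues appear in the order of \<open>es\<close>, so
  that they can later be prescribed in decreasing order.\<close>

lemma hermitian_diagonalization:
  fixes A :: "complex mat"
  assumes "A \<in> carrier_mat n n" "adj A = A" "char_poly A = (\<Prod>e\<leftarrow>es. [:- e, 1:])"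
  shows "\<exists>U. unitary_mat n U \<and> A = U * cdiag_mat n es * adj U"
  using assms
proof (induction es arbitrary: n A)
  case Nil
  with degree_monic_char_poly[of A n] have "n = 0" by auto
  with Nil show ?case
    by (intro exI[of _ "1\<^sub>m 0"]) (auto simp: unitary_mat_def intro!: eq_matI)
next
  case (Cons e es)
  note A = Cons.prems(1) and herm = Cons.prems(2)
  have cp: "char_poly A = [:- e, 1:] * (\<Prod>e\<leftarrow>es. [:- e, 1:])" using Cons.prems(3) by simp
  then have ev: "eigenvalue A e"
    unfolding eigenvalue_root_char_poly[OF A] by simp
  then obtain v where v: "v \<in> carrier_vec n" "v \<noteq> 0\<^sub>v n" "A *\<^sub>v v = e \<cdot>\<^sub>v v"
    using A by (auto simp: eigenvalue_def eigenvector_def)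
  have "n \<noteq> 0" using v by auto
  then obtain m where n: "n = Suc m" by (cases n) auto
  obtain W c where uW: "unitary_mat n W" and W0: "col W 0 = c \<cdot>\<^sub>v v"
    using unitary_with_first_column[OF v(1,2)] .
  note W = unitary_matD[OF uW]
  define A' where "A' = adj W * (A * W)"
  have A': "A' \<in> carrier_mat n n" using A W by (simp add: A'_def)
  have herm': "adj A' = A'"
    using A W herm by (simp add: A'_def adj_mult[of _ n n _ n] assoc_mult_mat[of _ n n _ n _ n])
  have AWA: "A = W * A' * adj W"
  proof -
    have "W * A' * adj W = (W * adj W) * A * (W * adj W)"
      using A W(1) by (simp add: A'_def assoc_mult_mat[of _ n n _ n _ n])
    then show ?thesis using A W by simp
  qed
  have "col (A * W) 0 = A *\<^sub>v (c \<cdot>\<^sub>v v)"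
    using A W(1) n by (simp only: col_mult2[of A n n W n] W0 zero_less_Suc)
  also have "\<dots> = c \<cdot>\<^sub>v (e \<cdot>\<^sub>v v)"
    unfolding mult_mat_vec[OF A v(1)] v(3) ..
  also have "\<dots> = e \<cdot>\<^sub>v col W 0"
    unfolding W0 by (simp add: smult_smult_assoc mult.commute)
  finally have "col (A * W) 0 = e \<cdot>\<^sub>v col W 0" .
  then have AW: "(A * W) $$ (k, 0) = e * W $$ (k, 0)" if "k < n" for k
    using arg_cong[of _ _ "\<lambda>x. x $ k"] A W(1) n that by fastforce
  \<comment> \<open>The first column of \<open>W\<close> is an eigenvector and is orthogonal to the
    other columns.\<close>
  have A'0: "A' $$ (i, 0) = (if i = 0 then e else 0)" if "i < n" for i
  proof -
    have "A' $$ (i, 0) = (\<Sum>k<n. adj W $$ (i, k) * (A * W) $$ (k, 0))"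
      using A W(1) that n unfolding A'_def by (intro index_mult_sum[of _ n n _ n]) auto
    also have "\<dots> = e * (\<Sum>k<n. adj W $$ (i, k) * W $$ (k, 0))"
      by (simp add: AW sum_distrib_left mult_ac)
    also have "(\<Sum>k<n. adj W $$ (i, k) * W $$ (k, 0)) = (adj W * W) $$ (i, 0)"
      using W(1) that n by (auto simp: scalar_prod_def lessThan_atLeast0 intro!: sum.cong)
    finally show ?thesis using W that n by auto
  qed
  \<comment> \<open>Hermitian symmetry carries the zeros over to the first row; in the corner it
    shows that \<open>e\<close> is real.\<close>
  have A'0': "A' $$ (0, j) = (if j = 0 then e else 0)" if "j < n" for j
  proof -
    have "A' $$ (0, j) = cnj (A' $$ (j, 0))"
      using herm' A' that n by (metis carrier_matD index_adj zero_less_Suc)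
    moreover have "e = cnj e"
      using herm' A' n A'0[of 0] by (metis carrier_matD index_adj zero_less_Suc)
    ultimately show ?thesis using A'0[OF that] by auto
  qed
  define A3 where "A3 = mat m m (\<lambda>(i, j). A' $$ (Suc i, Suc j))"
  have A3: "A3 \<in> carrier_mat m m" by (simp add: A3_def)
  have blk: "A' = four_block_mat (mat 1 1 (\<lambda>_. e)) (0\<^sub>m 1 m) (0\<^sub>m m 1) A3"
    using A' n A'0 A'0' by (intro eq_matI) (auto simp: A3_def)
  have herm3: "adj A3 = A3"
  proof (rule eq_matI)
    fix i j assume "i < dim_row A3" "j < dim_col A3"
    then have ij: "Suc i < n" "Suc j < n" "i < m" "j < m" using A3 n by auto
    have "A' $$ (Suc i, Suc j) = cnj (A' $$ (Suc j, Suc i))"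
      using herm' A' ij by (metis carrier_matD index_adj)
    then show "adj A3 $$ (i, j) = A3 $$ (i, j)" using ij by (simp add: A3_def)
  qed (use A3 in auto)
  have "similar_mat A' A"
    by (rule similar_matI[of _ _ "adj W" W n]) (use A A' W in \<open>auto simp: A'_def
        assoc_mult_mat[of _ n n _ n _ n]\<close>)
  from char_poly_similar[OF this] have "char_poly A' = [:- e, 1:] * (\<Prod>e\<leftarrow>es. [:- e, 1:])"
    using cp by simp
  also have "char_poly A' = char_poly (mat 1 1 (\<lambda>_. e)) * char_poly A3"
    unfolding blk by (rule char_poly_four_block_zeros_col) (use A3 in auto)
  also have "char_poly (mat 1 1 (\<lambda>_. e)) = [:- e, 1:]"
    by (simp add: char_poly_defs det_def sign_def)
  finally have "char_poly A3 = (\<Prod>e\<leftarrow>es. [:- e, 1:])"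
    by (metis mult_cancel_left pCons_eq_0_iff zero_neq_one)
  from Cons.IH[OF A3 herm3 this] obtain U3 where
    uU3: "unitary_mat m U3" and A3U: "A3 = U3 * cdiag_mat m es * adj U3" by auto
  note U3 = unitary_matD[OF uU3]
  define U' where "U' = four_block_mat (1\<^sub>m 1) (0\<^sub>m 1 m) (0\<^sub>m m 1) U3"
  have adjz: "adj (0\<^sub>m 1 m) = 0\<^sub>m m 1" "adj (0\<^sub>m m 1) = 0\<^sub>m 1 m"
    by (auto intro!: eq_matI)
  have adjU': "adj U' = four_block_mat (1\<^sub>m 1) (0\<^sub>m 1 m) (0\<^sub>m m 1) (adj U3)"
    unfolding U'_def using U3(1)
    by (subst adj_four_block[of _ 1 _ m]) (auto simp: adjz)
  have U': "U' \<in> carrier_mat n n" using U3 n by (auto simp: U'_def)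
  have "adj U' * U' = four_block_mat (1\<^sub>m 1) (0\<^sub>m 1 m) (0\<^sub>m m 1) (1\<^sub>m m)"
    unfolding adjU' unfolding U'_def
    by (subst mult_four_block_mat[of _ 1 1 _ m _ m _ _ 1 _ m]) (use U3 in auto)
  also have "\<dots> = 1\<^sub>m n" using n by (intro eq_matI) auto
  finally have uU': "unitary_mat n U'" using U' by (intro unitary_matI)
  have cd: "cdiag_mat n (e # es) = four_block_mat (mat 1 1 (\<lambda>_. e)) (0\<^sub>m 1 m) (0\<^sub>m m 1) (cdiag_mat m es)"
    using n by (intro eq_matI) (auto simp: cdiag_mat_def nth_Cons')
  have cdc: "cdiag_mat m es \<in> carrier_mat m m" "cdiag_mat n (e # es) \<in> carrier_mat n n"
    by (auto simp: cdiag_mat_def)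
  have step: "four_block_mat (1\<^sub>m 1) (0\<^sub>m 1 m) (0\<^sub>m m 1) X
      * four_block_mat (mat 1 1 (\<lambda>_. e)) (0\<^sub>m 1 m) (0\<^sub>m m 1) Y
    = four_block_mat (mat 1 1 (\<lambda>_. e)) (0\<^sub>m 1 m) (0\<^sub>m m 1) (X * Y)"
    "four_block_mat (mat 1 1 (\<lambda>_. e)) (0\<^sub>m 1 m) (0\<^sub>m m 1) X * four_block_mat (1\<^sub>m 1) (0\<^sub>m 1 m) (0\<^sub>m m 1) Y
    = four_block_mat (mat 1 1 (\<lambda>_. e)) (0\<^sub>m 1 m) (0\<^sub>m m 1) (X * Y)"
    if "X \<in> carrier_mat m m" "Y \<in> carrier_mat m m" for X Y
    using that by (subst mult_four_block_mat[of _ 1 1 _ m _ m _ _ 1 _ m]; auto)+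
  have "U' * cdiag_mat n (e # es) * adj U' = A'"
    unfolding cd adjU' blk A3U unfolding U'_def using U3(1) cdc by (simp add: step del: One_nat_def)
  then have "A = (W * U') * cdiag_mat n (e # es) * adj (W * U')"
    unfolding AWA using W(1) U' cdc
    by (subst (asm) eq_commute) (simp add: adj_mult[of _ n n _ n] assoc_mult_mat[of _ n n _ n _ n])
  then show ?case using unitary_mat_mult[OF uW uU'] by blast
qed

section \<open>Positive definiteness and congruence\<close>

lemma adj_mult_vec_cscalar_prod:
  assumes "T \<in> carrier_mat n n" "v \<in> carrier_vec n" "w \<in> carrier_vec n"
  shows "(adj T *\<^sub>v w) \<bullet>c v = w \<bullet>c (T *\<^sub>v v)"
proof -
  have "(adj T *\<^sub>v w) \<bullet>c v = (\<Sum>i<n. \<Sum>k<n. cnj (T $$ (k, i)) * w $ k * cnj (v $ i))"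
    using assms by (auto simp: scalar_prod_def lessThan_atLeast0 sum_distrib_right intro!: sum.cong)
  also have "\<dots> = (\<Sum>k<n. \<Sum>i<n. cnj (T $$ (k, i)) * w $ k * cnj (v $ i))"
    by (rule sum.swap)
  also have "\<dots> = w \<bullet>c (T *\<^sub>v v)"
    using assms by (auto simp: scalar_prod_def lessThan_atLeast0 sum_distrib_left intro!: sum.cong)
  finally show ?thesis .
qed

lemma cscalar_prod_self_pos:
  assumes "v \<in> carrier_vec n" "v \<noteq> 0\<^sub>v n" "\<And>i. i < n \<Longrightarrow> d i > 0"
  shows "(\<Sum>i<n. d i * (cmod (v $ i))\<^sup>2) > 0"
proof -
  obtain i where "i < n" "v $ i \<noteq> 0" using assms by (metis eq_vecI carrier_vecD index_zero_vec)
  then show ?thesis using assms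
      by (intro sum_pos2[of _ i]) (auto intro!: mult_nonneg_nonneg less_imp_le[OF assms(3)])
qed

abbreviation PD :: "nat \<Rightarrow> complex mat \<Rightarrow> bool" where
  "PD n M \<equiv> M \<in> carrier_mat n n \<and> pos_def_mat M"

lemma PD_iff:
  "PD n M \<longleftrightarrow> M \<in> carrier_mat n n \<and> adj M = M \<and>
    (\<forall>v\<in>carrier_vec n. v \<noteq> 0\<^sub>v n \<longrightarrow> Re ((M *\<^sub>v v) \<bullet>c v) > 0)"
  by (auto simp: pos_def_mat_def hermitian_mat_def)

text \<open>The left inverse \<open>S\<close> recovers \<open>v\<close> from
  \<open>T *\<^sub>v v\<close>, so \<open>T\<close> maps nonzero vectors to nonzero vectors and the
  quadratic form of \<open>M\<close> is positive there.\<close>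

lemma PD_congruence:
  assumes "PD n M" "T \<in> carrier_mat n n" "S \<in> carrier_mat n n" "S * T = 1\<^sub>m n"
  shows "PD n (adj T * M * T)"
  unfolding PD_iff
proof (intro conjI ballI impI)
  have M: "M \<in> carrier_mat n n" "adj M = M" using assms(1) unfolding PD_iff by auto
  show "adj T * M * T \<in> carrier_mat n n" using M assms by simp
  show "adj (adj T * M * T) = adj T * M * T"
    using M assms by (simp add: adj_mult[of _ n n _ n] assoc_mult_mat[of _ n n _ n _ n])
  fix v :: "complex vec" assume v: "v \<in> carrier_vec n" "v \<noteq> 0\<^sub>v n"
  have "S *\<^sub>v (T *\<^sub>v v) = v" using assms v by (simp flip: assoc_mult_mat_vec[of S n n T n v])
  moreover have "S *\<^sub>v 0\<^sub>v n = 0\<^sub>v n" using assms by (intro eq_vecI) auto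
  ultimately have "T *\<^sub>v v \<noteq> 0\<^sub>v n" using v by auto
  then have "Re ((M *\<^sub>v (T *\<^sub>v v)) \<bullet>c (T *\<^sub>v v)) > 0"
    using assms(1,2) v unfolding PD_iff by (metis mult_mat_vec_carrier)
  moreover have "(adj T * M * T) *\<^sub>v v = adj T *\<^sub>v (M *\<^sub>v (T *\<^sub>v v))"
    using M assms v by (simp add: assoc_mult_mat[of _ n n _ n _ n] assoc_mult_mat_vec[of _ n n _ n])
  moreover have "(adj T *\<^sub>v (M *\<^sub>v (T *\<^sub>v v))) \<bullet>c v = (M *\<^sub>v (T *\<^sub>v v)) \<bullet>c (T *\<^sub>v v)"
    using M(1) assms(2) v by (intro adj_mult_vec_cscalar_prod) auto
  ultimately show "Re (((adj T * M * T) *\<^sub>v v) \<bullet>c v) > 0" by simp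
qed

lemma PD_rdiag:
  assumes "\<And>i. i < n \<Longrightarrow> d i > 0" shows "PD n (rdiag_mat n d)"
  unfolding PD_iff
proof (intro conjI ballI impI)
  fix v :: "complex vec" assume v: "v \<in> carrier_vec n" "v \<noteq> 0\<^sub>v n"
  have "(rdiag_mat n d *\<^sub>v v) $ i = d i * v $ i" if "i < n" for i
    using v that by (simp add: scalar_prod_def if_distrib[of "\<lambda>x. x * _"] sum.delta cong: if_cong)
  then have "(rdiag_mat n d *\<^sub>v v) \<bullet>c v = (\<Sum>i<n. of_real (d i * (cmod (v $ i))\<^sup>2))"
    using v unfolding scalar_prod_def
    by (auto simp: lessThan_atLeast0 complex_norm_square mult.assoc simp
        del: index_mult_mat_vec of_real_power intro!: sum.cong)
  then show "Re ((rdiag_mat n d *\<^sub>v v) \<bullet>c v) > 0"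
    using cscalar_prod_self_pos[of v n d] v assms by simp
qed auto

text \<open>The condition under the choice operator in \<open>mat_powr\<close>; no order is imposed
  on \<open>d\<close>.\<close>

definition spectral_dec :: "nat \<Rightarrow> complex mat \<Rightarrow> complex mat \<Rightarrow> (nat \<Rightarrow> real) \<Rightarrow> bool" where
  "spectral_dec n M U d \<longleftrightarrow> unitary_mat n U \<and> (\<forall>i<n. d i > 0) \<and> M = U * rdiag_mat n d * adj U"

lemma spectral_dec_PD:
  assumes "spectral_dec n M U d" shows "PD n M"
proof -
  have U: "unitary_mat n U" and d: "\<And>i. i < n \<Longrightarrow> d i > 0" and M: "M = U * rdiag_mat n d * adj U"
    using assms by (auto simp: spectral_dec_def)
  show ?thesis
    using PD_congruence[OF PD_rdiag[of n d], of "adj U" U] d unitary_matD[OF U] M by simp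
qed

lemma char_poly_spectral:
  assumes "unitary_mat n U"
  shows "char_poly (U * rdiag_mat n d * adj U) = (\<Prod>e\<leftarrow>map (complex_of_real \<circ> d) [0..<n]. [:- e, 1:])"
proof -
  note U = unitary_matD[OF assms]
  have "similar_mat (U * rdiag_mat n d * adj U) (rdiag_mat n d)"
    by (rule similar_matI[of _ _ U "adj U" n]) (use U in auto)
  from char_poly_similar[OF this] have
      "char_poly (U * rdiag_mat n d * adj U) = char_poly (rdiag_mat n d)" .
  also have "\<dots> = (\<Prod>e\<leftarrow>diag_mat (rdiag_mat n d). [:- e, 1:])"
    by (rule char_poly_upper_triangular[of _ n]) auto
  also have "diag_mat (rdiag_mat n d) = map (complex_of_real \<circ> d) [0..<n]"
    by (auto simp: diag_mat_def)
  finally show ?thesis .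
qed

lemma proots_linear_factors: "proots (\<Prod>e\<leftarrow>es. [:- e, 1:]) = mset (es :: complex list)"
proof (induction es)
  case (Cons e es)
  have "(\<Prod>e\<leftarrow>es. [:- e, 1:]) \<noteq> (0 :: complex poly)" by (auto simp: prod_list_zero_iff)
  then have "proots ([:- e, 1:] * (\<Prod>e\<leftarrow>es. [:- e, 1:])) = {#e#} + mset es"
    using Cons by (subst proots_mult) auto
  then show ?case by simp
qed simp

lemma eigs_of_char_poly:
  assumes "char_poly M = (\<Prod>e\<leftarrow>map complex_of_real ds. [:- e, 1:])"
  shows "eigs M = rev (sort ds)"
proof -
  have "image_mset Re (proots (char_poly M)) = mset ds"
    unfolding assms proots_linear_factors by (simp add: multiset.map_comp o_def)
  then show ?thesis by (simp add: eigs_def)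
qed

text \<open>\<open>M\<close> is diagonalised twice: first with its roots in arbitrary order, which
  shows that they are real, and then with the sorted list \<open>eigs M\<close>, which by then is
  known to consist of the same roots.\<close>

lemma PD_spectral:
  assumes "PD n M"
  obtains U where "spectral_dec n M U (\<lambda>i. eigs M ! i)"
    "length (eigs M) = n" "sorted (rev (eigs M))"
proof -
  have M: "M \<in> carrier_mat n n" "adj M = M" using assms unfolding PD_iff by auto
  have diag_entry: "Im (es ! i) = 0 \<and> Re (es ! i) > 0"
    if i: "i < n" and U: "unitary_mat n U" and MU: "M = U * cdiag_mat n es * adj U" for U es i
  proof -
    note U = unitary_matD[OF U]
    have C: "cdiag_mat n es \<in> carrier_mat n n" by (simp add: cdiag_mat_def)
    have "adj U * M * U = (adj U * U) * cdiag_mat n es * (adj U * U)"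
      using U(1) C by (simp add: MU assoc_mult_mat[of _ n n _ n _ n])
    then have D: "adj U * M * U = cdiag_mat n es" using U C by simp
    \<comment> \<open>The diagonal matrix is congruent to \<open>M\<close>: being Hermitian makes
      its entries real, and testing the form on unit vectors makes them positive.\<close>
    have "PD n (cdiag_mat n es)"
      using PD_congruence[OF assms U(1) _ U(3)] U(1) D by simp
    then have a: "adj (cdiag_mat n es) = cdiag_mat n es"
      and p: "\<And>v. v \<in> carrier_vec n \<Longrightarrow> v \<noteq> 0\<^sub>v n \<Longrightarrow> Re ((cdiag_mat n es *\<^sub>v v) \<bullet>c v) > 0"
      unfolding PD_iff by auto
    have "adj (cdiag_mat n es) $$ (i, i) = cdiag_mat n es $$ (i, i)" using a by simp
    then have "cnj (es ! i) = es ! i" using i by (simp add: cdiag_mat_def)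
    then have "Im (es ! i) = 0" by (simp add: complex_eq_iff)
    moreover have "(cdiag_mat n es *\<^sub>v unit_vec n i) \<bullet>c unit_vec n i = es ! i"
    proof -
      have "conjugate (unit_vec n i :: complex vec) = unit_vec n i"
        using i by (intro eq_vecI) (auto simp: unit_vec_def)
      then show ?thesis using i C by (simp add: cdiag_mat_def)
    qed
    then have "Re (es ! i) > 0"
      using p[of "unit_vec n i"] i by auto
    ultimately show ?thesis by simp
  qed
  obtain es where es: "char_poly M = (\<Prod>e\<leftarrow>es. [:- e, 1:])" "length es = n"
    using char_poly_factorized[OF M(1)] by auto
  obtain U where "unitary_mat n U" "M = U * cdiag_mat n es * adj U"
    using hermitian_diagonalization[OF M es(1)] by auto
  then have "Im (es ! i) = 0" if "i < n" for i using diag_entry that by blast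
  then have es_Re: "es = map complex_of_real (map Re es)"
    using es(2) by (intro nth_equalityI) (auto simp: complex_eq_iff)
  have eigs: "eigs M = rev (sort (map Re es))"
    by (rule eigs_of_char_poly) (use es(1) es_Re in argo)
  then have len: "length (eigs M) = n" using es(2) by simp
  \<comment> \<open>Sorting does not change the multiset of roots, hence not the product of linear
    factors.\<close>
  have "mset es = mset (map complex_of_real (eigs M))"
    using arg_cong[OF es_Re, of mset] eigs by (simp add: multiset.map_comp)
  then have cp: "char_poly M = (\<Prod>e\<leftarrow>map complex_of_real (eigs M). [:- e, 1:])"
    unfolding es(1) prod_mset_prod_list[symmetric] mset_map by (simp only:)
  obtain U where U: "unitary_mat n U" "M = U * cdiag_mat n (map complex_of_real (eigs M)) * adj U"
    using hermitian_diagonalization[OF M cp] by auto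
  have "cdiag_mat n (map complex_of_real (eigs M)) = rdiag_mat n (\<lambda>i. eigs M ! i)"
    using len by (intro eq_matI) (auto simp: cdiag_mat_def)
  moreover have "eigs M ! i > 0" if "i < n" for i
    using diag_entry[OF that U] len that by simp
  ultimately have "spectral_dec n M U (\<lambda>i. eigs M ! i)"
    using U unfolding spectral_dec_def by metis
  then show thesis by (rule that) (use len eigs in auto)
qed

lemma eigs_spectral:
  assumes "spectral_dec n M U d" "\<And>i j. i \<le> j \<Longrightarrow> j < n \<Longrightarrow> d j \<le> d i"
  shows "eigs M = map d [0..<n]"
proof -
  have "char_poly M = (\<Prod>e\<leftarrow>map complex_of_real (map d [0..<n]). [:- e, 1:])"
    using char_poly_spectral[of n U d] assms(1) by (simp add: spectral_dec_def)
  then have "eigs M = rev (sort (map d [0..<n]))" by (rule eigs_of_char_poly)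
  also have "sort (map d [0..<n]) = rev (map d [0..<n])"
  proof (rule properties_for_sort)
    show "sorted (rev (map d [0..<n]))"
      using assms(2) by (auto simp: sorted_rev_iff_nth_mono)
  qed simp
  finally show ?thesis by simp
qed

text \<open>The unitary \<open>W = adj V * U\<close> satisfies
  \<open>W $$ (i, j) * d j = e i * W $$ (i, j)\<close>, so its entry vanishes unless
  \<open>d j = e i\<close>. Hence \<open>W\<close> also intertwines the diagonals after applying any
  \<open>f\<close>. This makes the choice in \<open>mat_powr\<close> harmless.\<close>

lemma spectral_calculus_unique:
  assumes U: "unitary_mat n U" and V: "unitary_mat n V"
    and eq: "U * rdiag_mat n d * adj U = V * rdiag_mat n e * adj V"
  shows "U * rdiag_mat n (\<lambda>i. f (d i)) * adj U = V * rdiag_mat n (\<lambda>i. f (e i)) * adj V"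
proof -
  note U = unitary_matD[OF U] and V = unitary_matD[OF V]
  note as = assoc_mult_mat[of _ n n _ n _ n]
  define W where "W = adj V * U"
  have W: "W \<in> carrier_mat n n" using U V by (simp add: W_def)
  have "W * rdiag_mat n d = adj V * (U * rdiag_mat n d * adj U) * U"
    using U V unfolding W_def by (simp add: as)
  also have "\<dots> = (adj V * V) * rdiag_mat n e * W"
    unfolding eq W_def using U(1) V(1) by (simp add: as)
  finally have "W * rdiag_mat n d = rdiag_mat n e * W" using V W by simp
  then have "W $$ (i, j) * d j = e i * W $$ (i, j)" if "i < n" "j < n" for i j
    using index_mult_rdiag_left[OF W that] index_mult_rdiag_right[OF W that] by metis
  then have W0: "W $$ (i, j) = 0 \<or> d j = e i" if "i < n" "j < n" for i j
    using that by (auto simp: mult.commute[of "W $$ (i, j)"])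
  have WD: "W * rdiag_mat n (\<lambda>i. f (d i)) = rdiag_mat n (\<lambda>i. f (e i)) * W"
  proof (intro eq_matI)
    fix i j assume "i < dim_row (rdiag_mat n (\<lambda>i. f (e i)) * W)"
        "j < dim_col (rdiag_mat n (\<lambda>i. f (e i)) * W)"
    then have ij: "i < n" "j < n" using W by auto
    show "(W * rdiag_mat n (\<lambda>i. f (d i))) $$ (i, j) = (rdiag_mat n (\<lambda>i. f (e i)) * W) $$ (i, j)"
      unfolding index_mult_rdiag_left[OF W ij] index_mult_rdiag_right[OF W ij]
      using W0[OF ij] by auto
  qed (use W in auto)
  have "U * rdiag_mat n (\<lambda>i. f (d i)) * adj U = (V * adj V) * U * rdiag_mat n (\<lambda>i. f (d i)) * adj U"
    using U V by simp
  also have "\<dots> = V * (W * rdiag_mat n (\<lambda>i. f (d i))) * adj U"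
    unfolding W_def using U(1) V(1) by (simp add: as)
  also have "\<dots> = V * rdiag_mat n (\<lambda>i. f (e i)) * adj V * (U * adj U)"
    unfolding WD unfolding W_def using U(1) V(1) by (simp add: as)
  finally show ?thesis using U V by simp
qed

lemma mat_powr_spectral:
  assumes "spectral_dec n M U d"
  shows "mat_powr M s = U * rdiag_mat n (\<lambda>i. d i powr s) * adj U"
proof -
  have n: "dim_row M = n" using spectral_dec_PD[OF assms] by auto
  have "\<exists>V e. unitary_mat n V \<and> (\<forall>i<n. e i > 0) \<and> M = V * rdiag_mat n e * adj V \<and>
      mat_powr M s = V * rdiag_mat n (\<lambda>i. e i powr s) * adj V"
    unfolding mat_powr_def n
    by (rule someI_ex) (use assms in \<open>unfold spectral_dec_def, blast\<close>)
  then obtain V e where V: "unitary_mat n V" and eq: "M = V * rdiag_mat n e * adj V"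
    and p: "mat_powr M s = V * rdiag_mat n (\<lambda>i. e i powr s) * adj V" by blast
  have U: "unitary_mat n U" "M = U * rdiag_mat n d * adj U"
    using assms unfolding spectral_dec_def by auto
  have "V * rdiag_mat n e * adj V = U * rdiag_mat n d * adj U" using eq U(2) by (rule subst)
  from spectral_calculus_unique[OF V U(1) this, of "\<lambda>x. x powr s"]
  show ?thesis unfolding p .
qed

section \<open>Gram determinants\<close>

text \<open>Maps from \<open>k\<close> row positions to \<open>n\<close> indices. Fixing them to be
  the identity elsewhere makes each one determined by its first \<open>k\<close> values and keeps
  the set stable under composition with permutations of \<open>{0..<k}\<close>.\<close>

definition index_maps :: "nat \<Rightarrow> nat \<Rightarrow> (nat \<Rightarrow> nat) set" where
  "index_maps k n = {f. (\<forall>i\<in>{0..<k}. f i \<in> {0..<n}) \<and> (\<forall>i. i \<notin> {0..<k} \<longrightarrow> f i = i)}"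

definition select_rows :: "nat \<Rightarrow> (nat \<Rightarrow> nat) \<Rightarrow> complex mat \<Rightarrow> complex mat" where
  "select_rows k f V = mat k k (\<lambda>(i, j). V $$ (f i, j))"

lemma select_rows_carrier [simp]: "select_rows k f V \<in> carrier_mat k k"
  by (simp add: select_rows_def)

text \<open>Each row of \<open>A * B\<close> is a combination of rows of \<open>B\<close>; the
  determinant is expanded multilinearly in the rows.\<close>

lemma det_mult_index_maps:
  fixes A B :: "complex mat"
  assumes A: "A \<in> carrier_mat k n" and B: "B \<in> carrier_mat n k"
  shows "det (A * B) = (\<Sum>f\<in>index_maps k n. (\<Prod>i = 0..<k. A $$ (i, f i)) * det (select_rows k f B))"
proof -
  have "det (A * B) = (\<Sum>f\<in>index_maps k n. det (mat\<^sub>r k k (\<lambda>i. A $$ (i, f i) \<cdot>\<^sub>v row B (f i))))"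
    unfolding mat_mul_finsum_alt[OF A B] index_maps_def
    by (rule det_linear_rows_sum) (use B in auto)
  also have "\<dots> = (\<Sum>f\<in>index_maps k n. (\<Prod>i = 0..<k. A $$ (i, f i)) * det (mat\<^sub>r k k (\<lambda>i. row B (f i))))"
    by (rule sum.cong[OF refl], rule det_rows_mul) (use B in auto)
  also have "\<dots> = (\<Sum>f\<in>index_maps k n. (\<Prod>i = 0..<k. A $$ (i, f i)) * det (select_rows k f B))"
  proof (rule sum.cong[OF refl])
    fix f assume "f \<in> index_maps k n"
    then have "mat\<^sub>r k k (\<lambda>i. row B (f i)) = select_rows k f B"
      using B by (intro eq_matI) (auto simp: select_rows_def index_maps_def)
    then show "(\<Prod>i = 0..<k. A $$ (i, f i)) * det (mat\<^sub>r k k (\<lambda>i. row B (f i)))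
        = (\<Prod>i = 0..<k. A $$ (i, f i)) * det (select_rows k f B)" by simp
  qed
  finally show ?thesis .
qed

lemma bij_betw_index_maps_comp:
  assumes "p permutes {0..<k}"
  shows "bij_betw (\<lambda>f. f \<circ> p) (index_maps k n) (index_maps k n)"
proof (rule bij_betwI[where g = "\<lambda>f. f \<circ> Hilbert_Choice.inv p"])
  have closed: "f \<circ> q \<in> index_maps k n" if "f \<in> index_maps k n" "q permutes {0..<k}" for f q
    using that permutes_in_image[OF that(2)] permutes_not_in[OF that(2)]
    by (auto simp: index_maps_def)
  show "(\<lambda>f. f \<circ> p) \<in> index_maps k n \<rightarrow> index_maps k n"
    "(\<lambda>f. f \<circ> Hilbert_Choice.inv p) \<in> index_maps k n \<rightarrow> index_maps k n"
    using closed assms permutes_inv[OF assms] by auto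
qed (use permutes_inv_o[OF assms] in \<open>auto simp: o_assoc[symmetric]\<close>)

text \<open>A Cauchy-Binet formula. Summing over all index maps instead of the increasing ones only costs the
  factor \<open>k!\<close>, since permuting the selected rows does not change the squared minor.\<close>

lemma det_weighted_gram:
  assumes V: "V \<in> carrier_mat n k"
  shows "fact k * det (adj V * rdiag_mat n d * V) =
    (\<Sum>f\<in>index_maps k n. of_real ((\<Prod>i = 0..<k. d (f i)) * (cmod (det (select_rows k f V)))\<^sup>2))"
proof -
  define G where "G f = of_real (\<Prod>i = 0..<k. d (f i)) * (\<Prod>i = 0..<k. cnj (V $$ (f i, i)))
      * det (select_rows k f V)" for f
  have "det (adj V * rdiag_mat n d * V) = (\<Sum>f\<in>index_maps k n. G f)"
  proof (subst det_mult_index_maps[of _ k n], goal_cases)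
    case 3
    have "(adj V * rdiag_mat n d) $$ (i, f i) = d (f i) * cnj (V $$ (f i, i))"
      if "f \<in> index_maps k n" "i < k" for f i
      using V that by (subst index_mult_rdiag_right[of _ k]) (auto simp: index_maps_def)
    then show ?case
      unfolding G_def by (intro sum.cong refl) (simp add: prod.distrib)
  qed (use V in auto)
  \<comment> \<open>Precomposing with a permutation only reorders the sum over \<open>f\<close>, so
    averaging over all \<open>p\<close> costs the factor \<open>k!\<close>.\<close>
  then have "fact k * det (adj V * rdiag_mat n d * V)
      = (\<Sum>p | p permutes {0..<k}. \<Sum>f\<in>index_maps k n. G f)"
    by (simp add: card_permutations[of "{0..<k}" k])
  also have "\<dots> = (\<Sum>p | p permutes {0..<k}. \<Sum>f\<in>index_maps k n. G (f \<circ> p))"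
    by (intro sum.cong refl sum.reindex_bij_betw[symmetric] bij_betw_index_maps_comp) auto
  also have "\<dots> = (\<Sum>f\<in>index_maps k n. \<Sum>p | p permutes {0..<k}. G (f \<circ> p))"
    by (rule sum.swap)
  also have "\<dots> = (\<Sum>f\<in>index_maps k n. of_real ((\<Prod>i = 0..<k. d (f i)) * (cmod (det (select_rows k f V)))\<^sup>2))"
  proof (rule sum.cong[OF refl])
    fix f assume "f \<in> index_maps k n"
    \<comment> \<open>Permuting the selected rows contributes a sign. Together with the product of
      conjugated entries it forms the Leibniz expansion of the conjugate determinant, so the sum
      over \<open>p\<close> is a squared modulus.\<close>
    have "G (f \<circ> p) = of_real (\<Prod>i = 0..<k. d (f i)) * det (select_rows k f V)
        * (signof p * (\<Prod>i = 0..<k. cnj (select_rows k f V $$ (p i, i))))"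
      if p: "p permutes {0..<k}" for p
    proof -
      have "(\<Prod>i = 0..<k. d (f (p i))) = (\<Prod>i = 0..<k. d (f i))"
        using prod.permute[OF p, of "\<lambda>i. d (f i)"] by (simp add: o_def)
      moreover have "select_rows k (f \<circ> p) V = mat k k (\<lambda>(i, j). select_rows k f V $$ (p i, j))"
        using permutes_in_image[OF p] by (intro eq_matI) (auto simp: select_rows_def)
      then have "det (select_rows k (f \<circ> p) V) = signof p * det (select_rows k f V)"
        by (simp add: det_permute_rows[OF _ p])
      moreover have "(\<Prod>i = 0..<k. cnj (V $$ ((f \<circ> p) i, i)))
          = (\<Prod>i = 0..<k. cnj (select_rows k f V $$ (p i, i)))"
        using permutes_in_image[OF p] by (intro prod.cong) (auto simp: select_rows_def)
      ultimately show ?thesis unfolding G_def by simp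
    qed
    then have "(\<Sum>p | p permutes {0..<k}. G (f \<circ> p)) = of_real (\<Prod>i = 0..<k. d (f i)) * det (select_rows k f V)
        * (\<Sum>p | p permutes {0..<k}. signof p * (\<Prod>i = 0..<k. cnj (select_rows k f V $$ (p i, i))))"
      by (simp add: sum_distrib_left)
    also have "(\<Sum>p | p permutes {0..<k}. signof p * (\<Prod>i = 0..<k. cnj (select_rows k f V $$ (p i, i))))
        = cnj (det (select_rows k f V))"
      by (subst det_col[of _ k]) (auto simp: lessThan_atLeast0)
    finally show "(\<Sum>p | p permutes {0..<k}. G (f \<circ> p))
        = of_real ((\<Prod>i = 0..<k. d (f i)) * (cmod (det (select_rows k f V)))\<^sup>2)"
      by (simp add: complex_norm_square mult.assoc o_def del: of_real_power)
  qed
  finally show ?thesis .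
qed

lemma det_select_rows_not_inj:
  assumes "\<not> inj_on f {0..<k}" shows "det (select_rows k f V) = 0"
proof -
  obtain i j where "i < k" "j < k" "i \<noteq> j" "f i = f j" using assms by (auto simp: inj_on_def)
  then show ?thesis
    by (intro det_identical_rows[of _ k i j]) (auto simp: select_rows_def)
qed

text \<open>Induction removing the largest index \<open>m\<close> of \<open>S\<close>: a set of
  \<open>k + 1\<close> indices has \<open>m \<ge> k\<close>, so
  \<open>d m \<le> d k\<close>.\<close>

lemma prod_le_prod_initial:
  fixes d :: "nat \<Rightarrow> real"
  assumes "\<And>i j. i \<le> j \<Longrightarrow> j < n \<Longrightarrow> d j \<le> d i" "\<And>i. i < n \<Longrightarrow> d i > 0"
  shows "S \<subseteq> {..<n} \<Longrightarrow> card S = k \<Longrightarrow> prod d S \<le> prod d {..<k}"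
proof (induction k arbitrary: S)
  case 0
  then have "S = {}" using finite_subset[of S "{..<n}"] by auto
  then show ?case by simp
next
  case (Suc k)
  have fin: "finite S" using Suc.prems finite_subset by blast
  define m where "m = Max S"
  have "S \<noteq> {}" using Suc.prems by auto
  then have m: "m \<in> S" using fin by (simp add: m_def)
  have "S \<subseteq> {..m}" using fin by (auto simp: m_def)
  then have "card S \<le> Suc m" using card_mono[of "{..m}" S] by simp
  then have km: "k \<le> m" using Suc.prems by simp
  have mn: "m < n" using m Suc.prems by auto
  have "prod d S = d m * prod d (S - {m})" using fin m by (rule prod.remove)
  also have "\<dots> \<le> d k * prod d {..<k}"
  proof (rule mult_mono)
    show "d m \<le> d k" using assms(1) km mn by auto
    show "prod d (S - {m}) \<le> prod d {..<k}" using Suc.IH[of "S - {m}"] Suc.prems m fin by auto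
    show "0 \<le> d k" using assms(2)[of k] km mn by auto
    show "0 \<le> prod d (S - {m})" using assms(2) Suc.prems(1)
        by (intro prod_nonneg) (auto intro!: less_imp_le)
  qed
  finally show ?case by (simp add: mult.commute)
qed

lemma Re_fact_mult: "Re (fact k * z) = fact k * Re z"
proof -
  have "fact k * z = complex_of_real (fact k) * z" by simp
  then show ?thesis by (simp del: of_real_fact)
qed

text \<open>The Gram determinant, that is, the squared volume spanned by the columns of
  \<open>V\<close>.\<close>

definition gram :: "complex mat \<Rightarrow> real" where
  "gram V = Re (det (adj V * V))"

lemma gram_eq_sum:
  assumes "V \<in> carrier_mat n k"
  shows "fact k * gram V = (\<Sum>f\<in>index_maps k n. (cmod (det (select_rows k f V)))\<^sup>2)"
proof -
  have "rdiag_mat n (\<lambda>_. 1) = 1\<^sub>m n" by (rule rdiag_one) simp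
  then have "fact k * det (adj V * V) = of_real (\<Sum>f\<in>index_maps k n. (cmod (det (select_rows k f V)))\<^sup>2)"
    using det_weighted_gram[OF assms, of "\<lambda>_. 1"] assms by simp
  from arg_cong[OF this, of Re] show ?thesis
    by (simp add: gram_def Re_fact_mult)
qed

lemma gram_nonneg:
  assumes "V \<in> carrier_mat n k" shows "gram V \<ge> 0"
proof -
  have "fact k * gram V \<ge> 0" unfolding gram_eq_sum[OF assms] by (rule sum_nonneg) simp
  then show ?thesis using fact_gt_zero[of k, where 'a = real] by (simp add: zero_le_mult_iff)
qed

text \<open>In the Cauchy-Binet sum an injective \<open>f\<close> carries the product of
  \<open>d\<close> over \<open>k\<close> distinct indices, at most that of the first
  \<open>k\<close>; a non-injective \<open>f\<close> repeats a row and has zero minor.\<close>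

lemma det_weighted_gram_le:
  fixes d :: "nat \<Rightarrow> real"
  assumes V: "V \<in> carrier_mat n k"
    and d: "\<And>i j. i \<le> j \<Longrightarrow> j < n \<Longrightarrow> d j \<le> d i" "\<And>i. i < n \<Longrightarrow> d i > 0"
  shows "Re (det (adj V * rdiag_mat n d * V)) \<le> (\<Prod>j<k. d j) * gram V"
proof -
  have "fact k * Re (det (adj V * rdiag_mat n d * V)) =
    (\<Sum>f\<in>index_maps k n. (\<Prod>i = 0..<k. d (f i)) * (cmod (det (select_rows k f V)))\<^sup>2)"
    using arg_cong[OF det_weighted_gram[OF V, of d], of Re] by (simp add: Re_fact_mult
        del: of_real_mult of_real_prod of_real_power)
  also have "\<dots> \<le> (\<Sum>f\<in>index_maps k n. (\<Prod>j<k. d j) * (cmod (det (select_rows k f V)))\<^sup>2)"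
  proof (rule sum_mono)
    fix f assume f: "f \<in> index_maps k n"
    show "(\<Prod>i = 0..<k. d (f i)) * (cmod (det (select_rows k f V)))\<^sup>2
        \<le> (\<Prod>j<k. d j) * (cmod (det (select_rows k f V)))\<^sup>2"
    proof (cases "inj_on f {0..<k}")
      case True
      have "(\<Prod>i = 0..<k. d (f i)) = prod d (f ` {0..<k})"
        using True by (simp add: prod.reindex)
      also have "\<dots> \<le> (\<Prod>j<k. d j)"
        by (rule prod_le_prod_initial[of n]) (use d f True in \<open>auto simp: index_maps_def card_image\<close>)
      finally show ?thesis by (intro mult_right_mono) auto
    qed (simp add: det_select_rows_not_inj)
  qed
  also have "\<dots> = (\<Prod>j<k. d j) * (fact k * gram V)"
    unfolding gram_eq_sum[OF V] sum_distrib_left ..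
  finally have "fact k * Re (det (adj V * rdiag_mat n d * V)) \<le> fact k * ((\<Prod>j<k. d j) * gram V)"
    by (simp add: mult_ac)
  then show ?thesis by (rule mult_left_le_imp_le) simp
qed

section \<open>Real powers of positive definite matrices\<close>

lemma det_rdiag: "det (rdiag_mat n d) = of_real (\<Prod>i<n. d i)"
proof -
  have "det (rdiag_mat n d) = prod_list (diag_mat (rdiag_mat n d))"
    by (rule det_upper_triangular[of _ n]) auto
  also have "\<dots> = (\<Prod>i<n. complex_of_real (d i))"
    using prod.distinct_set_conv_list[of "[0..<n]" "\<lambda>i. complex_of_real (d i)"]
    by (auto simp: diag_mat_def lessThan_atLeast0 intro!: arg_cong[of _ _ prod_list])
  finally show ?thesis by simp
qed

lemma det_spectral:
  assumes "spectral_dec n M U d" shows "det M = of_real (\<Prod>i<n. d i)"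
proof -
  have U: "unitary_mat n U" and M: "M = U * rdiag_mat n d * adj U"
    using assms unfolding spectral_dec_def by auto
  note U = unitary_matD[OF U]
  have "det U * det (adj U) = 1" using det_mult[of U n "adj U"] U by simp
  then have "det M = det (rdiag_mat n d)"
    unfolding M using U by (simp add: det_mult[of _ n] mult.commute)
  then show ?thesis by (simp add: det_rdiag)
qed

lemma spectral_dec_powr:
  assumes "spectral_dec n M U d" shows "spectral_dec n (mat_powr M s) U (\<lambda>i. d i powr s)"
proof -
  have "unitary_mat n U" "\<forall>i<n. d i > 0" using assms unfolding spectral_dec_def by auto
  then show ?thesis
    unfolding spectral_dec_def mat_powr_spectral[OF assms] by auto
qed

lemma PD_powr: "PD n M \<Longrightarrow> PD n (mat_powr M s)"
  by (metis PD_spectral spectral_dec_powr spectral_dec_PD)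

lemma powr_carrier [simp]: "PD n M \<Longrightarrow> mat_powr M s \<in> carrier_mat n n"
  using PD_powr by blast

lemma adj_PD: "PD n M \<Longrightarrow> adj M = M"
  unfolding PD_iff by simp

lemma adj_powr: "PD n M \<Longrightarrow> adj (mat_powr M s) = mat_powr M s"
  using PD_powr adj_PD by blast

lemma powr_add_mat:
  assumes "PD n M" shows "mat_powr M a * mat_powr M b = mat_powr M (a + b)"
proof -
  obtain U where dec: "spectral_dec n M U (\<lambda>i. eigs M ! i)" using PD_spectral[OF assms] .
  then have "unitary_mat n U" unfolding spectral_dec_def by simp
  note U = unitary_matD[OF this] and as = assoc_mult_mat[of _ n n _ n _ n]
  have "mat_powr M a * mat_powr M b = U * rdiag_mat n (\<lambda>i. (eigs M ! i) powr a) * (adj U * U)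
      * rdiag_mat n (\<lambda>i. (eigs M ! i) powr b) * adj U"
    unfolding mat_powr_spectral[OF dec] using U(1) by (simp add: as)
  also have "\<dots> = U * (rdiag_mat n (\<lambda>i. (eigs M ! i) powr a) * rdiag_mat n (\<lambda>i. (eigs M ! i) powr b))
      * adj U"
    unfolding U(3) using U(1) by (simp add: as)
  also have "\<dots> = mat_powr M (a + b)"
    unfolding mat_powr_spectral[OF dec] rdiag_mult by (simp add: powr_add)
  finally show ?thesis .
qed

text \<open>Once products are nested to the right, this merges adjacent powers of \<open>M\<close>
  in front of a further factor.\<close>

lemma powr_add_mat_assoc:
  assumes "PD n M" "X \<in> carrier_mat n k"
  shows "mat_powr M a * (mat_powr M b * X) = mat_powr M (a + b) * X"
  using assms by (simp flip: assoc_mult_mat[of _ n n _ n _ k] add: powr_add_mat[OF assms(1)])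

lemma powr_zero_mat:
  assumes "PD n M" shows "mat_powr M 0 = 1\<^sub>m n"
proof -
  obtain U where dec: "spectral_dec n M U (\<lambda>i. eigs M ! i)" using PD_spectral[OF assms] .
  then have U: "unitary_mat n U" and pos: "\<forall>i<n. eigs M ! i > 0" unfolding spectral_dec_def by auto
  have "rdiag_mat n (\<lambda>i. (eigs M ! i) powr 0) = 1\<^sub>m n"
    by (rule rdiag_one) (use pos in force)
  then show ?thesis unfolding mat_powr_spectral[OF dec] using unitary_matD[OF U] by simp
qed

lemma powr_one_mat:
  assumes "PD n M" shows "mat_powr M 1 = M"
proof -
  obtain U where dec: "spectral_dec n M U (\<lambda>i. eigs M ! i)" using PD_spectral[OF assms] .
  then have M: "M = U * rdiag_mat n (\<lambda>i. eigs M ! i) * adj U" and pos: "\<forall>i<n. eigs M ! i > 0"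
    unfolding spectral_dec_def by auto
  have "rdiag_mat n (\<lambda>i. (eigs M ! i) powr 1) = rdiag_mat n (\<lambda>i. eigs M ! i)"
    by (rule rdiag_cong) (use pos in force)
  then show ?thesis unfolding mat_powr_spectral[OF dec] using M by simp
qed

lemma powr_powr_mat:
  assumes "PD n M" shows "mat_powr (mat_powr M a) b = mat_powr M (a * b)"
proof -
  obtain U where dec: "spectral_dec n M U (\<lambda>i. eigs M ! i)" using PD_spectral[OF assms] .
  show ?thesis
    unfolding mat_powr_spectral[OF dec] mat_powr_spectral[OF spectral_dec_powr[OF dec], of a b,
      unfolded mat_powr_spectral[OF dec]]
    by (simp add: powr_powr)
qed

lemma powr_inverse:
  assumes "PD n M"
  shows "mat_powr M s * mat_powr M (- s) = 1\<^sub>m n" "mat_powr M (- s) * mat_powr M s = 1\<^sub>m n"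
  by (simp_all add: powr_add_mat[OF assms] powr_zero_mat[OF assms])

lemma powr_minus_one_unique:
  assumes "PD n M" "N \<in> carrier_mat n n" "M * N = 1\<^sub>m n"
  shows "mat_powr M (-1) = N"
proof -
  have M: "M \<in> carrier_mat n n" using assms(1) by simp
  have "mat_powr M (-1) * M = 1\<^sub>m n"
    using powr_inverse(2)[OF assms(1), of 1] powr_one_mat[OF assms(1)] by simp
  then have "(mat_powr M (-1) * M) * N = N" using assms(2) by simp
  also have "(mat_powr M (-1) * M) * N = mat_powr M (-1) * (M * N)"
    using assms(1,2) M by (intro assoc_mult_mat[of _ n n _ n _ n]) auto
  finally show ?thesis using assms(3) right_mult_one_mat[OF powr_carrier[OF assms(1)]] by simp
qed

lemma det_PD:
  assumes "PD n M" shows "det M = of_real (Re (det M))" "Re (det M) > 0"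
proof -
  obtain U where dec: "spectral_dec n M U (\<lambda>i. eigs M ! i)" using PD_spectral[OF assms] .
  then have "(\<Prod>i<n. eigs M ! i) > 0" unfolding spectral_dec_def by (intro prod_pos) auto
  with det_spectral[OF dec] show "det M = of_real (Re (det M))" "Re (det M) > 0"
    by (simp_all del: of_real_prod)
qed

lemma det_powr:
  assumes "PD n M" shows "det (mat_powr M s) = of_real (Re (det M) powr s)"
proof -
  obtain U where dec: "spectral_dec n M U (\<lambda>i. eigs M ! i)" using PD_spectral[OF assms] .
  then have pos: "\<forall>i<n. eigs M ! i > 0" unfolding spectral_dec_def by auto
  then have "(\<Prod>i<n. eigs M ! i) powr s = (\<Prod>i<n. (eigs M ! i) powr s)"
    by (intro prod_powr_distrib)
  then show ?thesis using det_spectral[OF dec] det_spectral[OF spectral_dec_powr[OF dec, of s]]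
    by (simp del: of_real_prod)
qed

lemma eigs_decreasing:
  assumes "PD n M" "i \<le> j" "j < n" shows "eigs M ! j \<le> eigs M ! i"
proof -
  have "length (eigs M) = n" "sorted (rev (eigs M))"
    using PD_spectral[OF assms(1)] by auto
  then show ?thesis using assms by (simp add: sorted_rev_iff_nth_mono)
qed

lemma eigs_pos:
  assumes "PD n M" "i < n" shows "eigs M ! i > 0"
  using PD_spectral[OF assms(1)] assms(2) by (auto simp: spectral_dec_def)

text \<open>A nonnegative exponent preserves the decreasing order, so the position \<open>i\<close>
  stays the same. Negative powers are therefore passed through the inverse matrix later.\<close>

lemma eigs_powr:
  assumes "PD n M" "s \<ge> 0" "i < n" shows "eigs (mat_powr M s) ! i = (eigs M ! i) powr s"
proof -
  obtain U where dec: "spectral_dec n M U (\<lambda>i. eigs M ! i)" using PD_spectral[OF assms(1)] .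
  have "eigs (mat_powr M s) = map (\<lambda>i. (eigs M ! i) powr s) [0..<n]"
  proof (rule eigs_spectral[OF spectral_dec_powr[OF dec]])
    fix i j assume ij: "i \<le> j" "j < n"
    show "(eigs M ! j) powr s \<le> (eigs M ! i) powr s"
      using eigs_decreasing[OF assms(1) ij] eigs_pos[OF assms(1) ij(2)] assms(2)
      by (intro powr_mono2) auto
  qed
  then show ?thesis using assms(3) by simp
qed

lemma eigs_similar: "similar_mat M N \<Longrightarrow> eigs M = eigs N"
  by (simp add: eigs_def char_poly_similar)

section \<open>Invertible matrices\<close>

definition nonsing :: "nat \<Rightarrow> complex mat \<Rightarrow> bool" where
  "nonsing n T \<longleftrightarrow> T \<in> carrier_mat n n \<and> (\<exists>S\<in>carrier_mat n n. S * T = 1\<^sub>m n \<and> T * S = 1\<^sub>m n)"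

lemma nonsing_carrier: "nonsing n T \<Longrightarrow> T \<in> carrier_mat n n"
  by (simp add: nonsing_def)

lemma nonsing_mult:
  assumes "nonsing n T" "nonsing n T'" shows "nonsing n (T * T')"
proof -
  obtain S S' where c: "T \<in> carrier_mat n n" "T' \<in> carrier_mat n n" "S \<in> carrier_mat n n"
      "S' \<in> carrier_mat n n"
    and S: "S * T = 1\<^sub>m n" "T * S = 1\<^sub>m n" "S' * T' = 1\<^sub>m n" "T' * S' = 1\<^sub>m n"
    using assms by (auto simp: nonsing_def)
  note as = assoc_mult_mat[of _ n n _ n _ n]
  have "(S' * S) * (T * T') = S' * (S * T) * T'" "(T * T') * (S' * S) = T * (T' * S') * S"
    using c by (simp_all add: as)
  then show ?thesis using c S unfolding nonsing_def by (intro conjI bexI[of _ "S' * S"]) auto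
qed

lemma nonsing_adj:
  assumes "nonsing n T" shows "nonsing n (adj T)"
proof -
  obtain S where c: "T \<in> carrier_mat n n" "S \<in> carrier_mat n n"
    and S: "S * T = 1\<^sub>m n" "T * S = 1\<^sub>m n"
    using assms by (auto simp: nonsing_def)
  have "adj S * adj T = 1\<^sub>m n" "adj T * adj S = 1\<^sub>m n"
    unfolding adj_mult[OF c, symmetric] adj_mult[OF c(2,1), symmetric] S by simp_all
  then show ?thesis using c unfolding nonsing_def by (intro conjI bexI[of _ "adj S"]) auto
qed

lemma nonsing_powr: "PD n M \<Longrightarrow> nonsing n (mat_powr M s)"
  unfolding nonsing_def using powr_inverse[of M n s]
  by (intro conjI bexI[of _ "mat_powr M (- s)"]) auto

lemma nonsing_PD: "PD n M \<Longrightarrow> nonsing n M"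
  using nonsing_powr[of M n 1] powr_one_mat[of M n] by simp

lemma PD_congruence_nonsing:
  assumes "PD n M" "nonsing n T" shows "PD n (adj T * M * T)"
  using assms PD_congruence[OF assms(1)] by (auto simp: nonsing_def)

lemma PD_one: "PD n (1\<^sub>m n)"
  using PD_rdiag[of n "\<lambda>_. 1"] rdiag_one[of n "\<lambda>_. 1"] by simp

lemma PD_gram:
  assumes "nonsing n T" shows "PD n (adj T * T)"
  using PD_congruence_nonsing[OF PD_one assms] nonsing_carrier[OF assms] by simp

section \<open>Products of the largest singular values\<close>

definition top_prod :: "nat \<Rightarrow> complex mat \<Rightarrow> real" where
  "top_prod k M = (\<Prod>j<k. eigs M ! j)"

text \<open>The product of the \<open>k\<close> largest squared singular values, written \<sigma>(T)
  in the opening remarks.\<close>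

definition top_sv :: "nat \<Rightarrow> complex mat \<Rightarrow> real" where
  "top_sv k T = top_prod k (adj T * T)"

text \<open>\<open>c\<close> bounds the expansion of squared \<open>k\<close>-dimensional volumes,
  in place of the squared norm of the \<open>k\<close>-th antisymmetric power of
  \<open>T\<close>.\<close>

definition gram_bound :: "nat \<Rightarrow> nat \<Rightarrow> complex mat \<Rightarrow> real \<Rightarrow> bool" where
  "gram_bound n k T c \<longleftrightarrow> (\<forall>V\<in>carrier_mat n k. gram (T * V) \<le> c * gram V)"

lemma gram_boundD: "gram_bound n k T c \<Longrightarrow> V \<in> carrier_mat n k \<Longrightarrow> gram (T * V) \<le> c * gram V"
  by (simp add: gram_bound_def)

lemma gram_bound_mult:
  assumes "gram_bound n k S c" "gram_bound n k T d" "c \<ge> 0"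
    and "S \<in> carrier_mat n n" "T \<in> carrier_mat n n"
  shows "gram_bound n k (S * T) (c * d)"
  unfolding gram_bound_def
proof
  fix V :: "complex mat" assume V: "V \<in> carrier_mat n k"
  have "gram (S * T * V) = gram (S * (T * V))" using assms V by
      (simp add: assoc_mult_mat[of _ n n _ n _ k])
  also have "\<dots> \<le> c * gram (T * V)" using assms(1) V assms(5) by (intro gram_boundD) auto
  also have "\<dots> \<le> c * (d * gram V)" using gram_boundD[OF assms(2) V] assms(3) by (rule mult_left_mono)
  finally show "gram (S * T * V) \<le> c * d * gram V" by (simp add: mult.assoc)
qed

lemma top_prod_pos: "PD n M \<Longrightarrow> k \<le> n \<Longrightarrow> top_prod k M > 0"
  unfolding top_prod_def using eigs_pos[of M n] by (intro prod_pos) auto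

lemma top_sv_pos: "nonsing n T \<Longrightarrow> k \<le> n \<Longrightarrow> top_sv k T > 0"
  unfolding top_sv_def using PD_gram[of n T] top_prod_pos by blast

lemma top_prod_powr:
  assumes "PD n M" "k \<le> n" "s \<ge> 0" shows "top_prod k (mat_powr M s) = top_prod k M powr s"
proof -
  have "top_prod k (mat_powr M s) = (\<Prod>j<k. (eigs M ! j) powr s)"
    unfolding top_prod_def using eigs_powr[OF assms(1,3)] assms(2) by (intro prod.cong) auto
  then show ?thesis unfolding top_prod_def by (simp add: prod_powr_distrib)
qed

lemma gram_mult_unitary:
  assumes "unitary_mat n U" "V \<in> carrier_mat n k" shows "gram (adj U * V) = gram V"
proof -
  note U = unitary_matD[OF assms(1)]
  have "adj (adj U * V) * (adj U * V) = adj V * ((U * adj U) * V)"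
    using U(1) assms(2) by (simp add: adj_mult[of _ n n _ k] assoc_mult_mat[of _ k n _ n _ k]
        assoc_mult_mat[of _ n n _ n _ k])
  then show ?thesis unfolding gram_def U(2) using assms(2) by simp
qed

text \<open>The diagonalising unitary is absorbed into \<open>V\<close>, which leaves
  \<open>gram V\<close> unchanged and reduces the claim to a diagonal matrix with decreasing
  entries.\<close>

lemma det_compression_le:
  assumes "PD n M" "V \<in> carrier_mat n k"
  shows "Re (det (adj V * M * V)) \<le> top_prod k M * gram V"
proof -
  obtain U where dec: "spectral_dec n M U (\<lambda>i. eigs M ! i)" using PD_spectral[OF assms(1)] .
  then have uU: "unitary_mat n U" and M: "M = U * rdiag_mat n (\<lambda>i. eigs M ! i) * adj U"
    unfolding spectral_dec_def by auto
  note U = unitary_matD[OF uU]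
  define V' where "V' = adj U * V"
  have V': "V' \<in> carrier_mat n k" using U assms by (simp add: V'_def)
  define D where "D = rdiag_mat n (\<lambda>i. eigs M ! i)"
  have D: "D \<in> carrier_mat n n" by (simp add: D_def)
  have "adj V' * D * V' = adj V * U * D * (adj U * V)"
    unfolding V'_def using U(1) assms(2) by (simp add: adj_mult[of _ n n _ k])
  also have "\<dots> = adj V * (U * D * adj U) * V"
    using U(1) assms(2) D
    by (simp add: assoc_mult_mat[of _ k n _ n _ n] assoc_mult_mat[of _ k n _ n _ k]
        assoc_mult_mat[of _ n n _ n _ n]
        assoc_mult_mat[of _ n n _ n _ k] mult_carrier_mat[of _ k n _ n])
  finally have "adj V * M * V = adj V' * D * V'" using M by (simp add: D_def)
  then have "Re (det (adj V * M * V)) \<le> top_prod k M * gram V'"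
    unfolding top_prod_def D_def
    using det_weighted_gram_le[OF V', of
        "\<lambda>i. eigs M ! i"] eigs_decreasing[OF assms(1)] eigs_pos[OF assms(1)]
    by simp
  then show ?thesis unfolding V'_def gram_mult_unitary[OF uU assms(2)] .
qed

lemma gram_bound_top_sv:
  assumes "nonsing n T" shows "gram_bound n k T (top_sv k T)"
  unfolding gram_bound_def
proof
  fix V :: "complex mat" assume V: "V \<in> carrier_mat n k"
  have T: "T \<in> carrier_mat n n" by (rule nonsing_carrier[OF assms])
  have "adj (T * V) * (T * V) = adj V * (adj T * T) * V"
    using T V by (simp add: adj_mult[of _ n n _ k] assoc_mult_mat[of _ k n _ n _ k]
        assoc_mult_mat[of _ n n _ n _ k])
  then show "gram (T * V) \<le> top_sv k T * gram V"
    using det_compression_le[OF PD_gram[OF assms] V] by (simp add: gram_def top_sv_def)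
qed

text \<open>The extremal \<open>V\<close>: its columns are the first \<open>k\<close> eigenvectors.
  The relation \<open>M * V = V * L\<close> says that they span an invariant subspace, a formulation
  that survives similarity.\<close>

lemma top_eigenvectors:
  assumes "PD n M" "k \<le> n"
  obtains V L where "V \<in> carrier_mat n k" "L \<in> carrier_mat k k" "adj V * V = 1\<^sub>m k"
    "M * V = V * L" "det L = of_real (top_prod k M)"
proof -
  obtain U where dec: "spectral_dec n M U (\<lambda>i. eigs M ! i)" using PD_spectral[OF assms(1)] .
  then have uU: "unitary_mat n U" and MU: "M = U * rdiag_mat n (\<lambda>i. eigs M ! i) * adj U"
    unfolding spectral_dec_def by auto
  note U = unitary_matD[OF uU]
  have M: "M \<in> carrier_mat n n" using assms(1) by simp
  define D where "D = rdiag_mat n (\<lambda>i. eigs M ! i)"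
  have D: "D \<in> carrier_mat n n" by (simp add: D_def)
  have "M * U = U * D * (adj U * U)"
    using U(1) D by (subst MU) (simp add: assoc_mult_mat[of _ n n _ n _ n] flip: D_def)
  then have MUD: "M * U = U * D" using U D by simp
  define V where "V = mat n k (\<lambda>(i, j). U $$ (i, j))"
  have V: "V \<in> carrier_mat n k" by (simp add: V_def)
  define L where "L = rdiag_mat k (\<lambda>i. eigs M ! i)"
  show thesis
  proof
    show "V \<in> carrier_mat n k" by fact
    show "L \<in> carrier_mat k k" by (simp add: L_def)
    show "adj V * V = 1\<^sub>m k"
    proof (rule eq_matI)
      fix i j assume "i < dim_row (1\<^sub>m k :: complex mat)" "j < dim_col (1\<^sub>m k :: complex mat)"
      then have ij: "i < k" "j < k" "i < n" "j < n" using assms(2) by auto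
      have "(adj V * V) $$ (i, j) = (adj U * U) $$ (i, j)"
        using ij U(1) V by (simp add: index_mult_sum[of _ k n _ k] index_mult_sum[of _ n n _ n]
            del: index_mult_mat(1))
           (simp add: V_def)
      then show "(adj V * V) $$ (i, j) = (1\<^sub>m k :: complex mat) $$ (i, j)" using U(3) ij by simp
    qed (use V in auto)
    show "M * V = V * L"
    proof (rule eq_matI)
      fix i j assume "i < dim_row (V * L)" "j < dim_col (V * L)"
      then have ij: "i < n" "j < k" "j < n" using V assms(2) by (auto simp: L_def)
      have "(M * V) $$ (i, j) = (M * U) $$ (i, j)"
        using ij M U(1) V by (simp add: index_mult_sum[of _ n n _ k] index_mult_sum[of _ n n _ n]
            del: index_mult_mat(1))
           (simp add: V_def)
      also have "\<dots> = U $$ (i, j) * eigs M ! j"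
        unfolding MUD D_def using ij by (intro index_mult_rdiag_right[OF U(1)]) auto
      also have "\<dots> = (V * L) $$ (i, j)"
        unfolding L_def using ij by (subst index_mult_rdiag_right[OF V]) (auto simp: V_def)
      finally show "(M * V) $$ (i, j) = (V * L) $$ (i, j)" .
    qed (use M V in \<open>auto simp: L_def\<close>)
    show "det L = of_real (top_prod k M)" by (simp add: L_def det_rdiag top_prod_def)
  qed
qed

lemma top_sv_le:
  assumes "nonsing n T" "k \<le> n" "gram_bound n k T c" shows "top_sv k T \<le> c"
proof -
  have T: "T \<in> carrier_mat n n" by (rule nonsing_carrier[OF assms(1)])
  obtain V L where V: "V \<in> carrier_mat n k" and L: "L \<in> carrier_mat k k" and VV: "adj V * V = 1\<^sub>m k"
    and TV: "adj T * T * V = V * L" and dL: "det L = of_real (top_prod k (adj T * T))"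
    using top_eigenvectors[OF PD_gram[OF assms(1)] assms(2)] .
  have "adj (T * V) * (T * V) = adj V * (adj T * T * V)"
    using T V by (simp add: adj_mult[of _ n n _ k] assoc_mult_mat[of _ k n _ n _ k]
        assoc_mult_mat[of _ n n _ n _ k])
  also have "\<dots> = (adj V * V) * L" unfolding TV using V L by (intro
      assoc_mult_mat[symmetric, of _ k n _ k _ k]) auto
  finally have "gram (T * V) = top_sv k T" using L dL VV by (simp add: gram_def top_sv_def)
  moreover have "gram V = 1" using VV by (simp add: gram_def)
  ultimately show ?thesis using gram_boundD[OF assms(3) V] by simp
qed

text \<open>\<open>T * adj T\<close> is \<open>adj T * T\<close> conjugated by \<open>T\<close>, so
  both have the same eigenvalues.\<close>

lemma top_sv_adj:
  assumes "nonsing n T" shows "top_sv k (adj T) = top_sv k T"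
proof -
  obtain S where c: "T \<in> carrier_mat n n" "S \<in> carrier_mat n n"
    and S: "S * T = 1\<^sub>m n" "T * S = 1\<^sub>m n"
    using assms by (auto simp: nonsing_def)
  have "T * (adj T * T) * S = T * adj T * (T * S)"
    using c by (simp add: assoc_mult_mat[of _ n n _ n _ n])
  then have "T * adj T = T * (adj T * T) * S" using c S by simp
  then have "similar_mat (T * adj T) (adj T * T)"
    by (intro similar_matI[of _ _ T S n]) (use c S in auto)
  then show ?thesis by (simp add: top_sv_def top_prod_def eigs_similar)
qed

text \<open>\<open>S * M * R\<close> need not be Hermitian, but it maps \<open>Y = S * V\<close> to
  \<open>Y * L\<close> for the top eigenvectors \<open>V\<close> of \<open>M\<close>. Thus it
  multiplies \<open>gram Y\<close> by exactly the square of \<open>det L\<close>, and any volume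
  bound \<open>c\<close> must be at least that.\<close>

lemma top_prod_similar_le:
  assumes M: "PD n M" and k: "k \<le> n" and R: "R \<in> carrier_mat n n" and S: "S \<in> carrier_mat n n"
    and inv: "R * S = 1\<^sub>m n" "S * R = 1\<^sub>m n" and bd: "gram_bound n k (S * M * R) c"
  shows "(top_prod k M)\<^sup>2 \<le> c"
proof -
  obtain V L where V: "V \<in> carrier_mat n k" and L: "L \<in> carrier_mat k k" and VV: "adj V * V = 1\<^sub>m k"
    and MV: "M * V = V * L" and dL: "det L = of_real (top_prod k M)"
    using top_eigenvectors[OF M k] .
  have Mc: "M \<in> carrier_mat n n" using M by simp
  define Y where "Y = S * V"
  have Y: "Y \<in> carrier_mat n k" using S V by (simp add: Y_def)
  have "R * Y = (R * S) * V" unfolding Y_def using R S V by (simp add: assoc_mult_mat[of _ n n _ n _ k])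
  then have RY: "R * Y = V" using inv V by simp
  have "nonsing n R" using R S inv by (auto simp: nonsing_def)
  \<comment> \<open>If \<open>gram Y\<close> were zero, the volume bound for \<open>R\<close> would
    contradict \<open>gram V = 1\<close>.\<close>
  then have "gram (R * Y) \<le> top_sv k R * gram Y"
    using gram_bound_top_sv Y by (blast intro: gram_boundD)
  then have "gram Y \<noteq> 0" unfolding RY using VV by (auto simp: gram_def)
  then have pos: "gram Y > 0" using gram_nonneg[OF Y] by simp
  have "S * M * R * Y = S * (M * (R * Y))"
    using S Mc R Y by (simp add: assoc_mult_mat[of _ n n _ n _ k])
  also have "\<dots> = Y * L" unfolding RY MV unfolding Y_def using S V L by
      (simp add: assoc_mult_mat[of _ n n _ k _ k])
  finally have WY: "S * M * R * Y = Y * L" .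
  have "adj (Y * L) * (Y * L) = adj L * (adj Y * Y) * L"
    using Y L by (simp add: adj_mult[of _ n k _ k] assoc_mult_mat[of _ k k _ k _ k]
        assoc_mult_mat[of _ k k _ n _ k]
        assoc_mult_mat[of _ k n _ k _ k] mult_carrier_mat[of _ k n _ k] mult_carrier_mat[of _ n k _ k])
  moreover have "adj Y * Y \<in> carrier_mat k k" using Y by auto
  ultimately have "det (adj (Y * L) * (Y * L)) = of_real ((top_prod k M)\<^sup>2) * det (adj Y * Y)"
    using L by (simp add: det_mult[of _ k] det_adj[OF L] dL power2_eq_square)
  then have "gram (Y * L) = (top_prod k M)\<^sup>2 * gram Y" by (simp add: gram_def del: of_real_power)
  then have "(top_prod k M)\<^sup>2 * gram Y \<le> c * gram Y"
    using gram_boundD[OF bd Y] unfolding WY by simp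
  then show ?thesis using pos by simp
qed

lemma top_sv_midpoint:
  assumes P: "PD n P" and Q: "PD n Q" and X: "nonsing n X" and k: "k \<le> n"
  shows "(top_sv k (mat_powr P ((a + b) / 2) * X * mat_powr Q ((a + b) / 2)))\<^sup>2
    \<le> top_sv k (mat_powr P a * X * mat_powr Q a) * top_sv k (mat_powr P b * X * mat_powr Q b)"
proof -
  define T where "T x = mat_powr P x * X * mat_powr Q x" for x
  define m where "m = (a + b) / 2"
  have Xc: "X \<in> carrier_mat n n" using X by (rule nonsing_carrier)
  note Pc = powr_carrier[OF P] and Qc = powr_carrier[OF Q]
  note as = assoc_mult_mat[of _ n n _ n _ n]
  have ns: "nonsing n (T x)" for x
    unfolding T_def by (intro nonsing_mult nonsing_powr P Q X)
  have Tc: "T x \<in> carrier_mat n n" for x using ns by (rule nonsing_carrier)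
  have adjT: "adj (T x) = mat_powr Q x * (adj X * mat_powr P x)" for x
    unfolding T_def using Xc Pc Qc
    by (simp add: adj_mult[of _ n n _ n] adj_powr[OF P] adj_powr[OF Q])
  have e: "a - m + m = a" "m + (b - m) = b" "m + m = a + b" "(a - m) + (b - m) = 0"
      "(b - m) + (a - m) = 0"
    by (auto simp: m_def field_simps)
  \<comment> \<open>Since \<open>a - m\<close> and \<open>b - m\<close> are opposite, the outer
    factors form a similarity. It splits the exponents of \<open>Q\<close> as \<open>a\<close> and
    \<open>b\<close>, while the inner \<open>P\<close> powers of total exponent \<open>a + b\<close>
    are split freely.\<close>
  have "mat_powr Q (a - m) * (adj (T m) * T m) * mat_powr Q (b - m)
      = mat_powr Q (a - m) * mat_powr Q m * (adj X * ((mat_powr P m * mat_powr P m) * (X * (mat_powr Q m * mat_powr Q (b - m)))))"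
    unfolding adjT unfolding T_def using Xc Pc Qc by (simp add: as)
  also have "\<dots> = mat_powr Q a * (adj X * ((mat_powr P a * mat_powr P b) * (X * mat_powr Q b)))"
    unfolding powr_add_mat[OF P] powr_add_mat[OF Q] e ..
  also have "\<dots> = adj (T a) * T b"
    unfolding adjT unfolding T_def using Xc Pc Qc by (simp add: as)
  finally have eq: "mat_powr Q (a - m) * (adj (T m) * T m) * mat_powr Q (b - m) = adj (T a) * T b" .
  have "gram_bound n k (adj (T a) * T b) (top_sv k (T a) * top_sv k (T b))"
  proof (rule gram_bound_mult)
    show "gram_bound n k (adj (T a)) (top_sv k (T a))"
      using gram_bound_top_sv[OF nonsing_adj[OF ns[of a]], of k] by (simp only: top_sv_adj[OF ns])
    show "gram_bound n k (T b) (top_sv k (T b))" by (rule gram_bound_top_sv[OF ns])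
    show "top_sv k (T a) \<ge> 0" using top_sv_pos[OF ns k] by (simp add: less_imp_le)
  qed (use Tc in auto)
  then have "(top_prod k (adj (T m) * T m))\<^sup>2 \<le> top_sv k (T a) * top_sv k (T b)"
    unfolding eq[symmetric]
    by (intro top_prod_similar_le[OF PD_gram[OF ns] k Qc Qc])
      (simp_all add: powr_add_mat[OF Q] e powr_zero_mat[OF Q])
  then show ?thesis unfolding top_sv_def[symmetric] unfolding T_def m_def .
qed

section \<open>Log-convexity\<close>

text \<open>If \<open>x\<close> were missing, the nearest points \<open>l < x < u\<close> of
  \<open>S\<close> on both sides would exist by compactness, and their midpoint would be a point of
  \<open>S\<close> nearer to \<open>x\<close> on one side.\<close>

lemma closed_midpoint_closed_interval:
  fixes S :: "real set"
  assumes "closed S" "\<And>x y. x \<in> S \<Longrightarrow> y \<in> S \<Longrightarrow> (x + y) / 2 \<in> S"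
    and "a \<in> S" "b \<in> S" "a \<le> x" "x \<le> b"
  shows "x \<in> S"
proof (rule ccontr)
  assume x: "x \<notin> S"
  have "compact ({a..x} \<inter> S)" "compact ({x..b} \<inter> S)"
    using assms(1) by (auto intro: compact_Int_closed)
  moreover have "{a..x} \<inter> S \<noteq> {}" "{x..b} \<inter> S \<noteq> {}" using assms by auto
  ultimately obtain l u where l: "l \<in> {a..x} \<inter> S" "\<forall>y\<in>{a..x} \<inter> S. y \<le> l"
    and u: "u \<in> {x..b} \<inter> S" "\<forall>y\<in>{x..b} \<inter> S. u \<le> y"
    using compact_attains_sup compact_attains_inf by meson
  have "l < x" "x < u" using l u x by (auto simp: less_le)
  moreover have m: "(l + u) / 2 \<in> S" using assms(2) l u by auto
  ultimately have "\<not> (l + u) / 2 \<le> l" "\<not> u \<le> (l + u) / 2" by auto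
  then have "(l + u) / 2 \<notin> {a..x}" "(l + u) / 2 \<notin> {x..b}"
    using l(2) u(2) m by blast+
  then show False using l(1) u(1) by auto
qed

section \<open>Entrywise continuity and interpolation between exponents\<close>

definition entrywise_cont :: "nat \<Rightarrow> nat \<Rightarrow> (real \<Rightarrow> complex mat) \<Rightarrow> bool" where
  "entrywise_cont m n F \<longleftrightarrow> (\<forall>x. F x \<in> carrier_mat m n) \<and>
    (\<forall>i<m. \<forall>j<n. continuous_on UNIV (\<lambda>x. F x $$ (i, j)))"

lemma entrywise_cont_const: "M \<in> carrier_mat m n \<Longrightarrow> entrywise_cont m n (\<lambda>_. M)"
  by (simp add: entrywise_cont_def)

lemma entrywise_cont_mult:
  assumes "entrywise_cont m n F" "entrywise_cont n l G"
  shows "entrywise_cont m l (\<lambda>x. F x * G x)"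
  unfolding entrywise_cont_def
proof (intro conjI allI impI)
  have c: "\<And>x. F x \<in> carrier_mat m n" "\<And>x. G x \<in> carrier_mat n l"
    using assms by (auto simp: entrywise_cont_def)
  then show "F x * G x \<in> carrier_mat m l" for x by (rule mult_carrier_mat)
  fix i j assume ij: "i < m" "j < l"
  have "(\<lambda>x. (F x * G x) $$ (i, j)) = (\<lambda>x. \<Sum>k<n. F x $$ (i, k) * G x $$ (k, j))"
    using index_mult_sum[OF c ij] by auto
  moreover have "continuous_on UNIV (\<lambda>x. \<Sum>k<n. F x $$ (i, k) * G x $$ (k, j))"
    using assms ij by (auto simp: entrywise_cont_def intro!: continuous_intros)
  ultimately show "continuous_on UNIV (\<lambda>x. (F x * G x) $$ (i, j))" by (simp only:)
qed

lemma entrywise_cont_adj: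
  assumes "entrywise_cont m n F" shows "entrywise_cont n m (\<lambda>x. adj (F x))"
  unfolding entrywise_cont_def
proof (intro conjI allI impI)
  have c: "F x \<in> carrier_mat m n" for x using assms by (auto simp: entrywise_cont_def)
  then show "adj (F x) \<in> carrier_mat n m" for x by simp
  fix i j assume ij: "i < n" "j < m"
  have "(\<lambda>x. adj (F x) $$ (i, j)) = (\<lambda>x. cnj (F x $$ (j, i)))"
    using ij c by (intro ext index_adj) (metis carrier_matD)+
  moreover have "continuous_on UNIV (\<lambda>x. cnj (F x $$ (j, i)))"
    using assms ij by (auto simp: entrywise_cont_def intro!: continuous_intros)
  ultimately show "continuous_on UNIV (\<lambda>x. adj (F x) $$ (i, j))" by (simp only:)
qed

lemma continuous_on_det:
  assumes "entrywise_cont n n F" shows "continuous_on UNIV (\<lambda>x. det (F x))"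
proof -
  have "F x \<in> carrier_mat n n" for x using assms by (auto simp: entrywise_cont_def)
  then have eq: "(\<lambda>x. det (F x)) = (\<lambda>x. \<Sum>p | p permutes {0..<n}. signof p * (\<Prod>i = 0..<n. F x $$ (i, p i)))"
    using det_def' by blast
  have "continuous_on UNIV (\<lambda>x. F x $$ (i, p i))" if "p permutes {0..<n}" "i < n" for p i
    using assms that permutes_in_image[OF that(1), of i] by (auto simp: entrywise_cont_def)
  then show ?thesis unfolding eq by (auto intro!: continuous_intros)
qed

lemma entrywise_cont_powr:
  assumes "PD n M" shows "entrywise_cont n n (\<lambda>x. mat_powr M x)"
proof -
  obtain U where dec: "spectral_dec n M U (\<lambda>i. eigs M ! i)" using PD_spectral[OF assms] .
  then have U: "U \<in> carrier_mat n n" using unitary_matD unfolding spectral_dec_def by blast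
  have "entrywise_cont n n (\<lambda>x. rdiag_mat n (\<lambda>i. (eigs M ! i) powr x))"
    unfolding entrywise_cont_def
  proof (intro conjI allI impI)
    fix i j assume ij: "i < n" "j < n"
    show "continuous_on UNIV (\<lambda>x. rdiag_mat n (\<lambda>i. (eigs M ! i) powr x) $$ (i, j))"
      using ij eigs_pos[OF assms ij(1)] by (cases "i = j") (auto intro!: continuous_intros)
  qed simp
  then show ?thesis
    unfolding mat_powr_spectral[OF dec]
    by (intro entrywise_cont_mult[of n n] entrywise_cont_const) (use U in auto)
qed

text \<open>Log-convexity in the form needed: a bound \<open>K * L powr x\<close> that holds at both
  ends of an interval holds inside. The exponents satisfying it form a closed set, and
  \<open>top_sv_midpoint\<close> makes it closed under midpoints.\<close>

lemma top_sv_three_lines: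
  assumes P: "PD n P" and Q: "PD n Q" and X: "nonsing n X" and k: "k \<le> n" and K: "K > 0" and L: "L > 0"
    and a: "top_sv k (mat_powr P a * X * mat_powr Q a) \<le> K * L powr a"
    and b: "top_sv k (mat_powr P b * X * mat_powr Q b) \<le> K * L powr b"
    and ab: "a \<le> x" "x \<le> b"
  shows "top_sv k (mat_powr P x * X * mat_powr Q x) \<le> K * L powr x"
proof -
  define T where "T x = mat_powr P x * X * mat_powr Q x" for x
  define S where "S = {x. top_sv k (T x) \<le> K * L powr x}"
  have ns: "nonsing n (T x)" for x
    unfolding T_def by (intro nonsing_mult nonsing_powr P Q X)
  \<comment> \<open>For each fixed \<open>V\<close> the condition involves only determinants, so
    closedness follows without proving that eigenvalues depend continuously on the matrix.\<close>
  have "S = (\<Inter>V\<in>carrier_mat n k. {x. gram (T x * V) \<le> K * L powr x * gram V})"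
  proof (intro equalityI subsetI INT_I CollectI)
    fix x and V :: "complex mat" assume "x \<in> S" and V: "V \<in> carrier_mat n k"
    have "gram (T x * V) \<le> top_sv k (T x) * gram V"
      by (rule gram_boundD[OF gram_bound_top_sv[OF ns] V])
    also have "\<dots> \<le> K * L powr x * gram V"
      using \<open>x \<in> S\<close> gram_nonneg[OF V] by (intro mult_right_mono) (auto simp: S_def)
    finally show "gram (T x * V) \<le> K * L powr x * gram V" .
  next
    fix x assume "x \<in> (\<Inter>V\<in>carrier_mat n k. {x. gram (T x * V) \<le> K * L powr x * gram V})"
    then show "x \<in> S" unfolding S_def
      by (intro CollectI top_sv_le[OF ns k]) (auto simp: gram_bound_def)
  qed
  moreover have "closed {x. gram (T x * V) \<le> K * L powr x * gram V}" if V: "V \<in> carrier_mat n k" for V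
  proof (rule closed_Collect_le)
    have "entrywise_cont n k (\<lambda>x. T x * V)"
      unfolding T_def using nonsing_carrier[OF X] V
      by (intro entrywise_cont_mult[of n n] entrywise_cont_const entrywise_cont_powr P Q) auto
    then have "entrywise_cont k k (\<lambda>x. adj (T x * V) * (T x * V))"
      by (intro entrywise_cont_mult[of k n] entrywise_cont_adj)
    then show "continuous_on UNIV (\<lambda>x. gram (T x * V))"
      unfolding gram_def by (intro continuous_intros continuous_on_det)
    show "continuous_on UNIV (\<lambda>x. K * L powr x * gram V)"
      using L by (intro continuous_intros) auto
  qed
  ultimately have "closed S" by auto
  moreover have "(x + y) / 2 \<in> S" if "x \<in> S" "y \<in> S" for x y
  proof -
    define m where "m = (x + y) / 2"
    have "(top_sv k (T m))\<^sup>2 \<le> top_sv k (T x) * top_sv k (T y)"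
      unfolding T_def m_def by (rule top_sv_midpoint[OF P Q X k])
    also have "\<dots> \<le> (K * L powr x) * (K * L powr y)"
      using that top_sv_pos[OF ns k] K unfolding S_def by (intro mult_mono) (auto intro: less_imp_le)
    also have "\<dots> = (K * L powr m)\<^sup>2"
      by (simp add: power2_eq_square m_def mult_ac flip: powr_add)
    finally have "top_sv k (T m) \<le> K * L powr m"
      by (rule power2_le_imp_le) (use K in simp)
    then show ?thesis by (simp add: S_def m_def)
  qed
  moreover have "a \<in> S" "b \<in> S" using a b by (auto simp: S_def T_def)
  ultimately have "x \<in> S" using closed_midpoint_closed_interval ab by blast
  then show ?thesis by (simp add: S_def T_def)
qed

section \<open>The majorization\<close>

text \<open>Here \<open>C\<close> is \<open>G\<close>, the square root of \<open>N\<close>, between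
  two factors \<open>mat_powr A (-1/2)\<close>. In \<open>C * A * C\<close> the inner powers of
  \<open>A\<close> cancel, leaving \<open>G * G = N\<close>, from which the outer powers then remove
  the factors around \<open>B\<close>.\<close>

lemma geo_mean_inverse_riccati:
  assumes A: "PD n A" and B: "PD n B"
  shows "PD n (geo_mean (mat_powr A (-1)) B)"
    "geo_mean (mat_powr A (-1)) B * A * geo_mean (mat_powr A (-1)) B = B"
proof -
  define N where "N = mat_powr A (1/2) * B * mat_powr A (1/2)"
  define G where "G = mat_powr N (1/2)"
  define C where "C = geo_mean (mat_powr A (-1)) B"
  note Ac = powr_carrier[OF A] and as = assoc_mult_mat[of _ n n _ n _ n]
  have Bc: "B \<in> carrier_mat n n" using B by simp
  have N: "PD n N"
    using PD_congruence_nonsing[OF B nonsing_powr[OF A, of "1/2"]] by (simp add: N_def adj_powr[OF A])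
  have G: "PD n G" unfolding G_def by (rule PD_powr[OF N])
  have GG: "G * G = N" unfolding G_def by (simp add: powr_add_mat[OF N] powr_one_mat[OF N])
  have C: "C = mat_powr A (-1/2) * G * mat_powr A (-1/2)"
    unfolding C_def geo_mean_def G_def N_def by (simp add: powr_powr_mat[OF A])
  have Gc: "G \<in> carrier_mat n n" using G by simp
  show "PD n (geo_mean (mat_powr A (-1)) B)"
    using PD_congruence_nonsing[OF G nonsing_powr[OF A, of "-1/2"]] unfolding C_def[symmetric] C
    by (simp add: adj_powr[OF A])
  have "C * A * C = C * mat_powr A 1 * C" by (simp add: powr_one_mat[OF A])
  also have "\<dots> = mat_powr A (-1/2) * ((G * G) * mat_powr A (-1/2))"
    unfolding C using Ac Gc
    by (simp add: as powr_add_mat_assoc[OF A, of _ n] powr_zero_mat[OF A])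
  also have "\<dots> = B"
    unfolding GG N_def using Ac Bc
    by (simp add: as powr_add_mat_assoc[OF A, of _ n] powr_add_mat[OF A] powr_zero_mat[OF A])
  finally show "geo_mean (mat_powr A (-1)) B * A * geo_mean (mat_powr A (-1)) B = B"
    unfolding C_def .
qed

lemma top_prod_one:
  assumes "k \<le> n" shows "top_prod k (1\<^sub>m n) = 1"
  using top_prod_powr[OF PD_one assms, of 0] top_prod_pos[OF PD_one assms]
  by (simp add: powr_zero_mat[OF PD_one])

text \<open>Interpolation with the identity in the middle between the exponents 0, where the value
  is 1, and 1, where it is \<open>top_sv k (P * Q)\<close>; hence \<open>K = 1\<close> and
  \<open>L = top_sv k (P * Q)\<close>.\<close>

lemma top_sv_cordes:
  assumes P: "PD n P" and Q: "PD n Q" and k: "k \<le> n" and x: "0 \<le> x" "x \<le> 1"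
  shows "top_sv k (mat_powr P x * mat_powr Q x) \<le> top_sv k (P * Q) powr x"
proof -
  have c: "P \<in> carrier_mat n n" "Q \<in> carrier_mat n n" using P Q by auto
  have "top_sv k (P * Q) > 0"
    by (rule top_sv_pos[OF nonsing_mult k]) (use P Q nonsing_PD in auto)
  moreover have "top_sv k (1\<^sub>m n) = 1" by (simp add: top_sv_def top_prod_one[OF k])
  ultimately have "top_sv k (mat_powr P x * 1\<^sub>m n * mat_powr Q x) \<le> 1 * top_sv k (P * Q) powr x"
    using c by (intro top_sv_three_lines[OF P Q nonsing_PD[OF PD_one] k _ _ _ _ x])
      (auto simp: powr_zero_mat[OF P] powr_zero_mat[OF Q] powr_one_mat[OF P] powr_one_mat[OF Q])
  then show ?thesis using right_mult_one_mat[OF powr_carrier[OF P]] by simp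
qed

text \<open>Casts conjugation by powers of \<open>A\<close> as a family covered by log-convexity,
  with \<open>Q\<close> the inverse of \<open>A\<close>. The two exponents on the right keep the sum
  \<open>2 * r\<close> while \<open>x\<close> varies.\<close>

lemma powr_conjugation:
  assumes A: "PD n A" and D: "D \<in> carrier_mat n n"
  shows "mat_powr A x * (mat_powr A r * D * mat_powr A r) * mat_powr (mat_powr A (-1)) x
    = mat_powr A (r + x) * D * mat_powr A (r - x)"
  using D powr_carrier[OF A]
  by (simp add: powr_powr_mat[OF A] assoc_mult_mat[of _ n n _ n _ n] powr_add_mat_assoc[OF A, of _ n]
      powr_add_mat[OF A] add.commute)

text \<open>The two matrices are adjoint to each other. In the family of
  \<open>powr_conjugation\<close> this makes \<open>top_sv\<close> even in \<open>x\<close>.\<close>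

lemma top_sv_swap:
  assumes A: "PD n A" and D: "PD n D"
  shows "top_sv k (mat_powr A x * D * mat_powr A y) = top_sv k (mat_powr A y * D * mat_powr A x)"
proof -
  have c: "D \<in> carrier_mat n n" using D by simp
  have "nonsing n (mat_powr A x * D * mat_powr A y)"
    by (intro nonsing_mult nonsing_powr A nonsing_PD D)
  from top_sv_adj[OF this, of k, symmetric] show ?thesis
    using c powr_carrier[OF A]
    by (simp add: adj_mult[of _ n n _ n] adj_powr[OF A] adj_PD[OF D] assoc_mult_mat[of _ n n _ n _ n])
qed

lemma top_sv_bound_pos:
  assumes A: "PD n A" and C: "PD n C" and k: "k \<le> n" and t: "0 < t" "t \<le> 1/2"
  shows "top_sv k (mat_powr A (1/2) * mat_powr C t)
    \<le> top_sv k (mat_powr A (1/2) * C * mat_powr A ((1 - t) / (2 * t))) powr t"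
proof -
  define r where "r = 1 / t"
  define K where "K = top_sv k (mat_powr A (1/2) * C * mat_powr A ((1 - t) / (2 * t)))"
  \<comment> \<open>The exponents \<open>1/2\<close> and \<open>(1 - t) / (2 * t)\<close> add up to
    \<open>r/2\<close>; \<open>X\<close> distributes them evenly.\<close>
  define X where "X = mat_powr A (r/4) * C * mat_powr A (r/4)"
  define Y where "Y = mat_powr C (1/2) * mat_powr A (r/4)"
  note Ac = powr_carrier[OF A] and Cc = powr_carrier[OF C] and as = assoc_mult_mat[of _ n n _ n _ n]
  have Cc1: "C \<in> carrier_mat n n" using C by simp
  have p: "(1 - t) / (2 * t) = r/4 - (2 - r)/4" using t by (simp add: r_def field_simps)
  have h: "1/2 = r/4 + (2 - r)/4" by (simp add: field_simps)
  have Kp: "K > 0" unfolding K_def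
    by (intro top_sv_pos[OF _ k] nonsing_mult nonsing_powr A nonsing_PD C)
  have nsX: "nonsing n X" unfolding X_def by (intro nonsing_mult nonsing_powr A nonsing_PD C)
  have nsY: "nonsing n Y" unfolding Y_def by (intro nonsing_mult nonsing_powr A C)
  define F where "F x = mat_powr A x * X * mat_powr (mat_powr A (-1)) x" for x
  have F: "F x = mat_powr A (r/4 + x) * C * mat_powr A (r/4 - x)" for x
    unfolding F_def X_def by (rule powr_conjugation[OF A Cc1])
  \<comment> \<open>\<open>q\<close> is the offset of \<open>1/2\<close> from the centre
    \<open>r/4\<close>. By evenness the values at \<open>q\<close> and \<open>- q\<close> are both
    \<open>K\<close>, so the midpoint inequality bounds the balanced matrix \<open>X\<close> by
    \<open>K\<close>.\<close>
  define q where "q = (2 - r)/4"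
  have "top_sv k (F q) = K" unfolding F K_def p h q_def ..
  moreover have "top_sv k (F (- q)) = top_sv k (F q)"
    unfolding F by (subst top_sv_swap[OF A C]) simp
  moreover have "(top_sv k (F ((q + - q) / 2)))\<^sup>2 \<le> top_sv k (F q) * top_sv k (F (- q))"
    unfolding F_def by (rule top_sv_midpoint[OF A PD_powr[OF A] nsX k])
  moreover have "F ((q + - q) / 2) = X" by (simp add: F X_def)
  ultimately have "(top_sv k X)\<^sup>2 \<le> K\<^sup>2" by (simp only: power2_eq_square)
  then have "top_sv k X \<le> K" by (rule power2_le_imp_le) (use Kp in simp)
  have XY: "X = adj Y * Y"
    unfolding X_def Y_def using Ac Cc Cc1
    by (simp add: adj_mult[of _ n n _ n] adj_powr[OF A] adj_powr[OF C] as
        powr_add_mat_assoc[OF C, of _ n]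
        powr_one_mat[OF C])
  have X: "PD n X" unfolding XY by (rule PD_gram[OF nsY])
  \<comment> \<open>\<open>X\<close> is itself positive definite, so \<open>top_sv k X\<close> is
    the square of \<open>top_prod k X\<close>; a square root therefore passes to the factor
    \<open>Y\<close> of \<open>X\<close>.\<close>
  have "adj X * X = mat_powr X 1 * mat_powr X 1" by (simp add: adj_PD[OF X] powr_one_mat[OF X])
  also have "\<dots> = mat_powr X 2" unfolding powr_add_mat[OF X] by simp
  finally have "top_sv k X = top_prod k X powr 2"
    unfolding top_sv_def using top_prod_powr[OF X k, of 2] by simp
  then have "top_prod k X powr 2 \<le> K" using \<open>top_sv k X \<le> K\<close> by simp
  then have "(top_prod k X powr 2) powr (1/2) \<le> K powr (1/2)" by (intro powr_mono2) auto
  then have "top_prod k X \<le> K powr (1/2)"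
    using top_prod_pos[OF X k] by (simp add: powr_powr)
  moreover have "top_prod k X = top_sv k (mat_powr A (r/4) * mat_powr C (1/2))"
  proof -
    have "top_prod k X = top_sv k (adj Y)" unfolding top_sv_adj[OF nsY] by (simp add: XY top_sv_def)
    also have "adj Y = mat_powr A (r/4) * mat_powr C (1/2)"
      unfolding Y_def using Ac Cc by (simp add: adj_mult[of _ n n _ n] adj_powr[OF A] adj_powr[OF C])
    finally show ?thesis .
  qed
  ultimately have le: "top_sv k (mat_powr A (r/4) * mat_powr C (1/2)) \<le> K powr (1/2)" by simp
  \<comment> \<open>The exponent \<open>2 * t\<close> turns \<open>r/4\<close> into
    \<open>1/2\<close> and \<open>1/2\<close> into \<open>t\<close>; it is at most 1 exactly because
    \<open>t \<le> 1/2\<close>.\<close>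
  have "top_sv k (mat_powr (mat_powr A (r/4)) (2 * t) * mat_powr (mat_powr C (1/2)) (2 * t))
      \<le> top_sv k (mat_powr A (r/4) * mat_powr C (1/2)) powr (2 * t)"
    by (rule top_sv_cordes[OF PD_powr[OF A] PD_powr[OF C] k]) (use t in auto)
  also have "\<dots> \<le> (K powr (1/2)) powr (2 * t)"
    using le t top_sv_pos[OF nonsing_mult[OF nonsing_powr[OF A] nonsing_powr[OF C]] k]
    by (intro powr_mono2) (auto intro: less_imp_le)
  also have "\<dots> = K powr t" by (simp add: powr_powr)
  also have "mat_powr (mat_powr A (r/4)) (2 * t) = mat_powr A (1/2)"
    using t by (simp add: powr_powr_mat[OF A] r_def)
  also have "mat_powr (mat_powr C (1/2)) (2 * t) = mat_powr C t"
    by (simp add: powr_powr_mat[OF C])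
  finally show ?thesis unfolding K_def .
qed

text \<open>Here the exponents are centred at \<open>r/4\<close> with offset
  \<open>(2 + r)/4\<close>, which exceeds \<open>r/4\<close>. So the family can be evaluated at
  \<open>x = r/4\<close>, where all of \<open>A\<close> stands on the left of \<open>D\<close>, and
  the Cordes exponent is \<open>s\<close>, which allows \<open>s\<close> up to 1.\<close>

lemma top_sv_bound_neg:
  assumes A: "PD n A" and D: "PD n D" and k: "k \<le> n" and s: "0 < s" "s \<le> 1"
  shows "top_sv k (mat_powr A (1/2) * mat_powr D s)
    \<le> top_sv k (mat_powr A (-1/2) * D * mat_powr A ((1 + s) / (2 * s))) powr s"
proof -
  define r where "r = 1 / s"
  define K where "K = top_sv k (mat_powr A (-1/2) * D * mat_powr A ((1 + s) / (2 * s)))"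
  define X where "X = mat_powr A (r/4) * D * mat_powr A (r/4)"
  have Dc: "D \<in> carrier_mat n n" using D by simp
  have r: "r > 0" using s by (simp add: r_def)
  have p: "(1 + s) / (2 * s) = r/4 - - ((2 + r)/4)" using s by (simp add: r_def field_simps)
  have h: "-1/2 = r/4 + - ((2 + r)/4)" by (simp add: field_simps)
  have Kp: "K > 0" unfolding K_def
    by (intro top_sv_pos[OF _ k] nonsing_mult nonsing_powr A nonsing_PD D)
  have nsX: "nonsing n X" unfolding X_def by (intro nonsing_mult nonsing_powr A nonsing_PD D)
  define F where "F x = mat_powr A x * X * mat_powr (mat_powr A (-1)) x" for x
  have F: "F x = mat_powr A (r/4 + x) * D * mat_powr A (r/4 - x)" for x
    unfolding F_def X_def by (rule powr_conjugation[OF A Dc])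
  have a: "top_sv k (F (- ((2 + r)/4))) = K" unfolding F K_def p h ..
  have b: "top_sv k (F ((2 + r)/4)) = top_sv k (F (- ((2 + r)/4)))"
    unfolding F by (subst top_sv_swap[OF A D]) simp
  \<comment> \<open>Both endpoint values equal \<open>K\<close>, so the interpolating bound is
    constant: \<open>L = 1\<close>.\<close>
  have "top_sv k (F (r/4)) \<le> K * 1 powr (r/4)"
    unfolding F_def
    by (rule top_sv_three_lines[OF A PD_powr[OF A] nsX k Kp, where a = "- ((2 + r)/4)" and b =
        "(2 + r)/4"])
      (use a b r in \<open>auto simp: field_simps simp flip: F_def\<close>)
  moreover have "F (r/4) = mat_powr A (r/2) * D"
    unfolding F using Dc powr_carrier[OF A] by (simp add: powr_zero_mat[OF A])
  ultimately have le: "top_sv k (mat_powr A (r/2) * D) \<le> K" by simp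
  have "top_sv k (mat_powr (mat_powr A (r/2)) s * mat_powr D s) \<le> top_sv k (mat_powr A (r/2) * D) powr s"
    by (rule top_sv_cordes[OF PD_powr[OF A] D k]) (use s in auto)
  also have "\<dots> \<le> K powr s"
    using le s top_sv_pos[OF nonsing_mult[OF nonsing_powr[OF A] nonsing_PD[OF D]] k]
    by (intro powr_mono2) (auto intro: less_imp_le)
  also have "mat_powr (mat_powr A (r/2)) s = mat_powr A (1/2)"
    using s by (simp add: powr_powr_mat[OF A] r_def)
  finally show ?thesis unfolding K_def .
qed

theorem theorem4p8:
  fixes A B :: "complex mat" and n :: nat and t :: real
  assumes "A \<in> carrier_mat n n" and "B \<in> carrier_mat n n"
    and "pos_def_mat A" and "pos_def_mat B"
    and "-1 \<le> t" and "t \<le> 1/2" and "t \<noteq> 0"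
  shows "log_majorized (sp_hat t A B)
           (mat_powr (mat_powr A ((1 - t) / (2 * t)) * B * mat_powr A ((1 - t) / (2 * t))) t)"
proof -
  define C where "C = geo_mean (mat_powr A (-1)) B"
  define p where "p = (1 - t) / (2 * t)"
  define N where "N = mat_powr A p * B * mat_powr A p"
  have A: "PD n A" and B: "PD n B" using assms by auto
  have C: "PD n C" and CAC: "C * A * C = B"
    using geo_mean_inverse_riccati[OF A B] by (auto simp: C_def)
  note Ac = powr_carrier[OF A] and Cc = powr_carrier[OF C] and as = assoc_mult_mat[of _ n n _ n _ n]
  note simps = as adj_mult[of _ n n _ n] adj_powr[OF A] adj_powr[OF C] powr_add_mat_assoc[OF A, of _ n]
    powr_add_mat_assoc[OF C, of _ n] powr_add_mat[OF A] powr_add_mat[OF C] powr_zero_mat[OF A]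
        powr_zero_mat[OF C]
    left_mult_one_mat[of _ n n]
  have N: "PD n N"
    using PD_congruence_nonsing[OF B nonsing_powr[OF A, of p]] by (simp add: N_def adj_powr[OF A])
  have sp: "sp_hat t A B = mat_powr C t * A * mat_powr C t" by (simp add: sp_hat_def C_def)
  \<comment> \<open>Writing first powers explicitly lets the exponent rules combine all
    factors.\<close>
  have B': "B = mat_powr C 1 * mat_powr A 1 * mat_powr C 1"
    using CAC by (simp add: powr_one_mat[OF A] powr_one_mat[OF C])
  have "sp_hat t A B = mat_powr C t * mat_powr A 1 * mat_powr C t"
    by (simp add: sp powr_one_mat[OF A])
  also have "\<dots> = adj (mat_powr A (1/2) * mat_powr C t) * (mat_powr A (1/2) * mat_powr C t)"
    using Ac Cc by (simp add: simps)
  finally have lhs: "top_prod k (sp_hat t A B) = top_sv k (mat_powr A (1/2) * mat_powr C t)" for k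
    by (simp add: top_sv_def)
  have bound: "top_prod k (sp_hat t A B) \<le> top_prod k (mat_powr N t)" if k: "k \<le> n" for k
  proof (cases "t > 0")
    case True
    have "N = adj (mat_powr A (1/2) * mat_powr C 1 * mat_powr A p) * (mat_powr A (1/2) * mat_powr C 1
        * mat_powr A p)"
      unfolding N_def B' using Ac Cc by (simp add: simps)
    then have "top_prod k (mat_powr N t) = top_sv k (mat_powr A (1/2) * C * mat_powr A p) powr t"
      using top_prod_powr[OF N k, of t] True by (simp add: top_sv_def powr_one_mat[OF C])
    then show ?thesis using top_sv_bound_pos[OF A C k True assms(6)] by (simp add: lhs p_def)
  next
    case False
    define s where "s = - t"
    define D where "D = mat_powr C (-1)"
    have s: "0 < s" "s \<le> 1" using False assms by (auto simp: s_def)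
    \<comment> \<open>The inverse of \<open>N\<close> factors as \<open>adj W * W\<close>. Thus
      \<open>mat_powr N t\<close> is a positive power \<open>s\<close> of a Gram matrix, which keeps
      the eigenvalues in decreasing order.\<close>
    define W where "W = mat_powr A (-1/2) * D * mat_powr A (- p)"
    have Wc: "adj W * W \<in> carrier_mat n n" using Ac Cc by (simp add: W_def D_def)
    have "N * (adj W * W) = 1\<^sub>m n"
      unfolding N_def B' W_def D_def using Ac Cc by (simp add: simps)
    then have inv: "mat_powr N (-1) = adj W * W" by (rule powr_minus_one_unique[OF N Wc])
    have "mat_powr N t = mat_powr (mat_powr N (-1)) s" by (simp add: powr_powr_mat[OF N] s_def)
    then have "top_prod k (mat_powr N t) = top_sv k W powr s"
      using top_prod_powr[OF PD_powr[OF N, of "-1"] k, of s] s by (simp add: inv top_sv_def)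
    moreover have "mat_powr C t = mat_powr D s" by (simp add: D_def powr_powr_mat[OF C] s_def)
    moreover have "- p = (1 + s) / (2 * s)" by (simp add: p_def s_def)
    moreover have "PD n D" unfolding D_def by (rule PD_powr[OF C])
    ultimately show ?thesis using top_sv_bound_neg[OF A _ k s] by (simp add: lhs W_def)
  qed
  \<comment> \<open>Determinants: both sides give \<open>a * c powr (2 * t)\<close>, because
    \<open>2 * p + 1 = 1 / t\<close>.\<close>
  define a c where "a = Re (det A)" and "c = Re (det C)"
  have a: "det A = of_real a" "a > 0" and c: "det C = of_real c" "c > 0"
    using det_PD[OF A] det_PD[OF C] by (auto simp: a_def c_def)
  have dA: "det (mat_powr A x) = of_real (a powr x)"
      and dC: "det (mat_powr C x) = of_real (c powr x)" for x
    using det_powr[OF A] det_powr[OF C] by (auto simp: a_def c_def)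
  have "det (sp_hat t A B) = of_real (c powr t * a * c powr t)"
    unfolding sp using Ac Cc A by (simp add: det_mult[of _ n] dC a)
  moreover have "det N = of_real (a powr p * (c * a * c) * a powr p)"
    unfolding N_def CAC[symmetric] using Ac A C by (simp add: det_mult[of _ n] dA a c)
  then have "det (mat_powr N t) = of_real ((a powr p * (c * a * c) * a powr p) powr t)"
    unfolding det_powr[OF N] by (simp only: Re_complex_of_real)
  moreover have "(a powr p * (c * a * c) * a powr p) powr t = c powr t * a * c powr t"
  proof -
    have "a powr p * (c * a * c) * a powr p = (a powr p * a powr 1 * a powr p) * (c * c)"
      using a by (simp add: mult_ac)
    also have "a powr p * a powr 1 * a powr p = a powr (1 / t)"
      unfolding powr_add[symmetric] using assms(7) by (simp add: p_def field_simps)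
    finally have eq: "a powr p * (c * a * c) * a powr p = a powr (1 / t) * (c * c)" .
    show ?thesis unfolding eq using a c assms(7) by (simp add: powr_mult powr_powr)
  qed
  ultimately have "det (sp_hat t A B) = det (mat_powr N t)" by simp
  moreover have "dim_row (sp_hat t A B) = n" using carrier_matD(1)[OF Cc] unfolding sp by simp
  ultimately have "log_majorized (sp_hat t A B) (mat_powr N t)"
    using bound unfolding log_majorized_def top_prod_def by auto
  then show ?thesis by (simp add: N_def p_def)
qed

end
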